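(* Let $N\ge3$ be an integer, $s\in(0,1)$, and let $G\in C^1([0,+\infty))$ be a Young function, $G(t)=\int_0^tg(\tau)\,d\tau$, such that for some constants $p^-,p^+$ $$1\le p^-\le\frac{tg(t)}{G(t)}\le p^+<\infty\quad\text{for all }t>0.$$ Let $M>0$ and let $(u_n)\subset W^{s,G}(\mathbb{R}^N)$ be such that $\Phi_{s,G,\mathbb{R}^N}(u_n)^{1/p^-}\le M$ and $\Phi_{s,G,\mathbb{R}^N}(u_n)^{1/p^+}\le M$ for all $n$. Let $\tau,\delta>0$ be such that $$\operatorname{mes}\left(\{x\in\mathbb{R}^N:|u_n(x)|>\tau\}\right)\ge\delta\quad\text{for all }n\in\mathbb{N}.$$ Then there is a sequence $(y_n)\subset\mathbb{Z}^N$ such that $v_n(x)=u_n(x+y_n)$ has a subsequence whose limit in $L^G_{loc}(\mathbb{R}^N)$ (exists and) is nontrivial, i.e. not a.e. zero.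
   Context: A Young function is a map $G:[0,\infty)\to[0,\infty)$ of the form $G(t)=\int_0^t g(\tau)\,d\tau$ where $g:[0,\infty)\to[0,\infty)$ is right continuous, $g(0)=0$, $g(t)>0$ for $t>0$, $g$ is non-decreasing on $(0,\infty)$ and $\lim_{t\to\infty}g(t)=\infty$. $\operatorname{mes}$ is Lebesgue measure. With $D_su(x,y)=\frac{u(x)-u(y)}{|x-y|^s}$ and $d\mu=\frac{dx\,dy}{|x-y|^N}$, put $\Phi_{s,G,\mathbb{R}^N}(u)=\iint_{\mathbb{R}^N\times\mathbb{R}^N}G(|D_su|)\,d\mu$. For measurable $\Omega\subseteq\mathbb{R}^N$, $L^G(\Omega)$ is the set of measurable $u:\Omega\to\mathbb{R}$ with $\int_\Omega G(\lambda|u|)\,dx<\infty$ for some $\lambda>0$, with norm $\|u\|_{L^G(\Omega)}=\inf\{\lambda>0:\int_\Omega G(|u|/\lambda)\,dx\le1\}$. $W^{s,G}(\mathbb{R}^N)$ is the set of $u\in L^G(\mathbb{R}^N)$ with $\Phi_{s,G,\mathbb{R}^N}(\lambda u)<\infty$ for some $\lambda>0$. Convergence in $L^G_{loc}(\mathbb{R}^N)$ means convergence in $L^G(\Omega)$ for every bounded measurable $\Omega\subset\mathbb{R}^N$. *)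

theory Defs
  imports "HOL-Analysis.Analysis"
begin

(* Functions on [0,\<infinity>) are total functions on the reals of which only the values on {0..} matter. *)

definition young_function :: "(real \<Rightarrow> real) \<Rightarrow> (real \<Rightarrow> real) \<Rightarrow> bool" where
  "young_function G g \<longleftrightarrow>
     (\<forall>t\<ge>0. 0 \<le> g t) \<and>
     (\<forall>t\<ge>0. continuous (at_right t) g) \<and>
     g 0 = 0 \<and> (\<forall>t>0. 0 < g t) \<and>
     mono_on {0<..} g \<and>
     filterlim g at_top at_top \<and>
     (\<forall>t\<ge>0. (g has_integral G t) {0..t})"

(* At the endpoint 0 the derivative is the one-sided one. *)
definition C1_half_line :: "(real \<Rightarrow> real) \<Rightarrow> bool" where
  "C1_half_line G \<longleftrightarrow>
     (\<exists>G'. (\<forall>t\<ge>0. (G has_real_derivative G' t) (at t within {0..})) \<and> continuous_on {0..} G')"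

definition D_quot :: "real \<Rightarrow> (real ^ 'n \<Rightarrow> real) \<Rightarrow> real ^ 'n \<Rightarrow> real ^ 'n \<Rightarrow> real" where
  "D_quot s u x y = (u x - u y) / norm (x - y) powr s"

(* Division by zero yields 0 on the diagonal, which is a null set. *)
definition mu :: "((real ^ 'n) \<times> (real ^ 'n)) measure" where
  "mu = density (lebesgue \<Otimes>\<^sub>M lebesgue) (\<lambda>(x, y). ennreal (1 / norm (x - y) ^ CARD('n)))"

definition Phi :: "real \<Rightarrow> (real \<Rightarrow> real) \<Rightarrow> (real ^ 'n \<Rightarrow> real) \<Rightarrow> ennreal" where
  "Phi s G u = (\<integral>\<^sup>+ (x, y). ennreal (G \<bar>D_quot s u x y\<bar>) \<partial>mu)"

definition LG :: "(real \<Rightarrow> real) \<Rightarrow> (real ^ 'n) set \<Rightarrow> (real ^ 'n \<Rightarrow> real) set" where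
  "LG G \<Omega> = {u. u \<in> borel_measurable (lebesgue_on \<Omega>) \<and>
     (\<exists>l>0. (\<integral>\<^sup>+ x. ennreal (G (l * \<bar>u x\<bar>)) \<partial>lebesgue_on \<Omega>) < \<infinity>)}"

(* Only meaningful for u in LG G \<Omega>, where the set is nonempty. *)
definition LG_norm :: "(real \<Rightarrow> real) \<Rightarrow> (real ^ 'n) set \<Rightarrow> (real ^ 'n \<Rightarrow> real) \<Rightarrow> real" where
  "LG_norm G \<Omega> u = Inf {l. l > 0 \<and> (\<integral>\<^sup>+ x. ennreal (G (\<bar>u x\<bar> / l)) \<partial>lebesgue_on \<Omega>) \<le> 1}"

definition LG_converges ::
  "(real \<Rightarrow> real) \<Rightarrow> (real ^ 'n) set \<Rightarrow> (nat \<Rightarrow> real ^ 'n \<Rightarrow> real) \<Rightarrow> (real ^ 'n \<Rightarrow> real) \<Rightarrow> bool" where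
  "LG_converges G \<Omega> f v \<longleftrightarrow>
     (\<forall>k. f k \<in> LG G \<Omega>) \<and> v \<in> LG G \<Omega> \<and>
     (\<lambda>k. LG_norm G \<Omega> (\<lambda>x. f k x - v x)) \<longlonglongrightarrow> 0"

definition LG_loc_converges ::
  "(real \<Rightarrow> real) \<Rightarrow> (nat \<Rightarrow> real ^ 'n \<Rightarrow> real) \<Rightarrow> (real ^ 'n \<Rightarrow> real) \<Rightarrow> bool" where
  "LG_loc_converges G f v \<longleftrightarrow>
     (\<forall>\<Omega>. bounded \<Omega> \<and> \<Omega> \<in> sets lebesgue \<longrightarrow> LG_converges G \<Omega> f v)"

definition WsG :: "real \<Rightarrow> (real \<Rightarrow> real) \<Rightarrow> (real ^ 'n \<Rightarrow> real) set" where
  "WsG s G = {u. u \<in> LG G UNIV \<and> (\<exists>l>0. Phi s G (\<lambda>x. l * u x) < \<infinity>)}"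

end

(* Write E for the set where |u| > tau/2. If E filled less than half of every ball of a small radius h,
   the Gagliardo kernel would force Phi(u) >= c delta h^(-s), contradicting the energy bound; so E fills half
   of some ball. Since E has finite measure, stepping along a line reaches two neighbouring balls, one at least
   half filled by E and the other less than half filled. Translate them near the origin by an integer vector.
   The second ball contains many points where |u| <= tau/2; comparing with a well chosen one of them bounds
   the modular of the translates on every ball, although no global bound is available. The first ball
   prevents the limit from vanishing.
   Compactness: on cubes of side 1/K the translates are approximated in modular by constants with error
   O(K^(-s)) uniformly in n; a diagonal subsequence makes all the constants converge, so it is Cauchy. *)

theory Submission
  imports Defs "HOL-Complex_Analysis.Great_Picard" "HOL-Real_Asymp.Real_Asymp"
begin

text \<open>The energy \<open>Phi\<close> does not change when a constant is added to u, and no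
  uniform bound in L^G is assumed, so an energy bound alone gives local compactness only up to
  additive constants. Translates centred where |u| is large could grow without bound on every ball.
  Hence the search for a place where a fixed amount of volume above the level tau/2 lies next to a
  fixed amount below it. Using two levels creates a gap: a point above tau and a point at or below
  tau/2 differ by at least tau/2, and this difference feeds the kernel.

  Estimates are made for the modular, the integral of G(|u|), and only the last step passes to the
  norm. The bound t g(t) / G(t) <= p^+ yields doubling of G, which stands in for the triangle
  inequality and converts modular convergence into norm convergence. Convexity, in the form G(l t)
  <= l G(t) for 0 <= l <= 1, is the source of the powers h^(-s) and K^(-s). The comparison constants
  are values u(y) at points y chosen by averaging the energy, which avoids averaging u
  itself.\<close>

section \<open>Lebesgue measure: sigma-finiteness, translations, choice by averaging\<close>

lemma sigma_finite_lebesgue: "sigma_finite_measure (lebesgue :: 'a::euclidean_space measure)"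
proof
  show "\<exists>A::'a set set. countable A \<and> A \<subseteq> sets lebesgue \<and> \<Union> A = space lebesgue \<and> (\<forall>a\<in>A. emeasure lebesgue a \<noteq> \<infinity>)"
  proof (intro exI[of _ "range (\<lambda>n. cball 0 (real n))"] conjI ballI)
    show "\<Union> (range (\<lambda>n. cball (0::'a) (real n))) = space lebesgue"
      by (auto simp: real_arch_simple)
    show "emeasure lebesgue a \<noteq> \<infinity>" if "a \<in> range (\<lambda>n. cball (0::'a) (real n))" for a
      using that emeasure_bounded_finite[of a] by auto
  qed auto
qed

lemma measurable_lebesgue_translation [measurable]:
  "(\<lambda>x. x + a) \<in> (lebesgue :: 'a::euclidean_space measure) \<rightarrow>\<^sub>M lebesgue"
  using lebesgue_affine_measurable[of "\<lambda>_. 1" a]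
  by (simp add: euclidean_representation add.commute)

lemma nn_integral_lebesgue_translation:
  fixes f :: "'a::euclidean_space \<Rightarrow> ennreal"
  assumes [measurable]: "f \<in> borel_measurable lebesgue"
  shows "(\<integral>\<^sup>+ x. f (x + a) \<partial>lebesgue) = (\<integral>\<^sup>+ x. f x \<partial>lebesgue)"
proof -
  have "(lebesgue :: 'a measure) = distr lebesgue lebesgue (\<lambda>x. x + a)"
    using lebesgue_affine_euclidean[of "\<lambda>_. 1" a]
    by (simp add: euclidean_representation add.commute density_1)
  then have "(\<integral>\<^sup>+ x. f x \<partial>lebesgue) = (\<integral>\<^sup>+ x. f x \<partial>distr lebesgue lebesgue (\<lambda>x. x + a))"
    by metis
  also have "\<dots> = (\<integral>\<^sup>+ x. f (x + a) \<partial>lebesgue)"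
    by (subst nn_integral_distr) auto
  finally show ?thesis by simp
qed

text \<open>If f exceeded its mean c at every point of A, then (f - c) would be positive on A and
  yet have integral zero there. The strict inequality at a single point already forces the integral
  to be finite, so the subtraction in \<open>ennreal\<close> is legitimate.\<close>

lemma exists_le_average:
  fixes f :: "'a \<Rightarrow> ennreal"
  assumes [measurable]: "f \<in> borel_measurable M" "A \<in> sets M"
    and nz: "emeasure M A \<noteq> 0" and fin: "emeasure M A \<noteq> \<infinity>"
  shows "\<exists>y\<in>A. emeasure M A * f y \<le> (\<integral>\<^sup>+ x\<in>A. f x \<partial>M)"
proof (rule ccontr)
  assume contra: "\<not> ?thesis"
  define I where "I = (\<integral>\<^sup>+ x\<in>A. f x \<partial>M)"
  define c where "c = I / emeasure M A"
  have gt: "I < emeasure M A * f y" if "y \<in> A" for y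
    using contra that by (auto simp: not_le I_def)
  have "A \<noteq> {}" using nz by auto
  then obtain y where "y \<in> A" by blast
  then have I: "I \<noteq> \<infinity>"
    using gt[of y] by auto
  have mc: "emeasure M A * c = I"
    using nz fin unfolding c_def
    by (simp add: ennreal_times_divide mult.commute[of _ I] ennreal_mult_divide_eq)
  have lt: "c < f y" if "y \<in> A" for y
    using gt[OF that] mc by (metis mult_left_mono not_le zero_le)
  have c: "c \<noteq> \<infinity>"
    using lt[OF \<open>y \<in> A\<close>] by auto
  have "(\<integral>\<^sup>+ x. (f x - c) * indicator A x \<partial>M) = (\<integral>\<^sup>+ x. f x * indicator A x - c * indicator A x \<partial>M)"
    by (intro nn_integral_cong) (auto simp: indicator_def)
  also have "\<dots> = I - (\<integral>\<^sup>+ x. c * indicator A x \<partial>M)"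
    unfolding I_def
  proof (rule nn_integral_diff)
    show "(\<integral>\<^sup>+ x. c * indicator A x \<partial>M) \<noteq> \<infinity>"
      using c fin by (simp add: nn_integral_cmult_indicator ennreal_mult_eq_top_iff)
    show "AE x in M. c * indicator A x \<le> f x * indicator A x"
      using lt by (auto simp: indicator_def less_imp_le)
  qed measurable
  also have "\<dots> = 0"
    using mc I by (simp add: nn_integral_cmult_indicator mult.commute)
  finally have "AE x in M. (f x - c) * indicator A x = 0"
    by (subst (asm) nn_integral_0_iff_AE) auto
  then have "AE x in M. x \<notin> A"
    by eventually_elim (use lt c in \<open>auto simp: indicator_def diff_eq_0_iff_ennreal split: if_splits dest!: leD\<close>)
  then show False
    using nz AE_iff_null_sets[OF \<open>A \<in> sets M\<close>] by auto
qed

section \<open>Doubling convex functions and their modular\<close>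

text \<open>The properties of G on which the analysis rests, separated from the density g and the
  exponents. \<open>scale\<close> is convexity together with G 0 = 0, restricted to chords through
  the origin; \<open>delta2\<close> is the doubling condition.\<close>

locale delta2_young =
  fixes G :: "real \<Rightarrow> real"
  assumes zero: "G 0 = 0"
    and pos: "0 < t \<Longrightarrow> 0 < G t"
    and mono: "0 \<le> a \<Longrightarrow> a \<le> b \<Longrightarrow> G a \<le> G b"
    and scale: "0 \<le> l \<Longrightarrow> l \<le> 1 \<Longrightarrow> 0 \<le> t \<Longrightarrow> G (l * t) \<le> l * G t"
    and cont: "continuous_on {0..} G"
    and delta2: "\<exists>D>0. \<forall>t\<ge>0. G (2 * t) \<le> D * G t"
begin

lemma nonneg: "0 \<le> t \<Longrightarrow> 0 \<le> G t"
  using mono[of 0 t] zero by simp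

abbreviation eG :: "real \<Rightarrow> ennreal" where
  "eG x \<equiv> ennreal (G \<bar>x\<bar>)"

lemma continuous_on_G_abs: "continuous_on UNIV (\<lambda>x. G \<bar>x\<bar>)"
  by (rule continuous_on_compose2[OF cont]) (auto intro!: continuous_intros)

lemma borel_measurable_G_abs [measurable]: "(\<lambda>x. G \<bar>x\<bar>) \<in> borel_measurable borel"
  using borel_measurable_continuous_onI[OF continuous_on_G_abs] .

lemma eG_mono: "\<bar>x\<bar> \<le> \<bar>y\<bar> \<Longrightarrow> eG x \<le> eG y"
  by (intro ennreal_leI mono) auto

text \<open>Doubling is iterated k times with 2^k above c; monotonicity does the rest.\<close>

lemma G_dilation:
  assumes "0 \<le> c"
  shows "\<exists>C>0. \<forall>t\<ge>0. G (c * t) \<le> C * G t"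
proof -
  obtain D where D: "D > 0" "\<And>t. 0 \<le> t \<Longrightarrow> G (2 * t) \<le> D * G t"
    using delta2 by blast
  have pow: "G (2 ^ k * t) \<le> D ^ k * G t" if "0 \<le> t" for t k
  proof (induction k)
    case (Suc k)
    have "G (2 ^ Suc k * t) \<le> D * G (2 ^ k * t)"
      using D(2)[of "2 ^ k * t"] that by (simp add: mult.assoc)
    also have "\<dots> \<le> D * (D ^ k * G t)"
      using Suc D(1) by (intro mult_left_mono) auto
    finally show ?case by (simp add: mult.assoc)
  qed simp
  obtain k where "c < 2 ^ k"
    using real_arch_pow[of 2 c] by auto
  then have "G (c * t) \<le> D ^ k * G t" if "0 \<le> t" for t
    using pow[OF that, of k] mono[of "c * t" "2 ^ k * t"] that assms
    by (meson less_imp_le mult_nonneg_nonneg mult_right_mono order_trans)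
  then show ?thesis
    using D(1) by (intro exI[of _ "D ^ k"]) auto
qed

lemma eG_dilation:
  shows "\<exists>C>0. \<forall>x. eG (c * x) \<le> ennreal C * eG x"
proof -
  obtain C where C: "C > 0" "\<And>t. 0 \<le> t \<Longrightarrow> G (\<bar>c\<bar> * t) \<le> C * G t"
    using G_dilation[of "\<bar>c\<bar>"] by auto
  then have "eG (c * x) \<le> ennreal C * eG x" for x
    using C(2)[of "\<bar>x\<bar>"] by (subst ennreal_mult[symmetric]) (auto simp: abs_mult nonneg)
  with C(1) show ?thesis by blast
qed

text \<open>The modular has no triangle inequality. Since |x + y| is at most twice the larger of |x|
  and |y|, doubling gives this substitute, whose constant is paid once for each splitting.\<close>

lemma eG_add: "\<exists>C>0. \<forall>x y. eG (x + y) \<le> ennreal C * (eG x + eG y)"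
proof -
  obtain C where C: "C > 0" "\<And>x. eG (2 * x) \<le> ennreal C * eG x"
    using eG_dilation[of 2] by auto
  have "eG (x + y) \<le> ennreal C * (eG x + eG y)" for x y
  proof (cases "\<bar>x\<bar> \<le> \<bar>y\<bar>")
    case True
    then have "eG (x + y) \<le> eG (2 * y)" by (intro eG_mono) auto
    also have "\<dots> \<le> ennreal C * eG y" by (rule C)
    also have "\<dots> \<le> ennreal C * (eG x + eG y)" by (intro mult_left_mono) auto
    finally show ?thesis .
  next
    case False
    then have "eG (x + y) \<le> eG (2 * x)" by (intro eG_mono) auto
    also have "\<dots> \<le> ennreal C * eG x" by (rule C)
    also have "\<dots> \<le> ennreal C * (eG x + eG y)" by (intro mult_left_mono) auto
    finally show ?thesis .
  qed
  with C(1) show ?thesis by blast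
qed

lemma G_ge_linear:
  assumes "1 \<le> t"
  shows "t * G 1 \<le> G t"
  using scale[of "1 / t" t] assms by (simp add: field_simps)

text \<open>Convexity makes G grow at least linearly beyond 1, so a bound on G bounds its argument.
  This later turns modular bounds for constants into bounds to which sequential compactness
  applies.\<close>

lemma abs_le_of_G_le:
  assumes "G \<bar>x\<bar> \<le> b"
  shows "\<bar>x\<bar> \<le> max 1 (b / G 1)"
proof (cases "1 \<le> \<bar>x\<bar>")
  case True
  then show ?thesis
    using G_ge_linear[of "\<bar>x\<bar>"] assms pos[of 1]
    by (auto simp: field_simps le_max_iff_disj)
qed auto

end

section \<open>Young functions with bounded exponent are convex and doubling\<close>

lemma young_function_increment:
  assumes Y: "young_function G g" and ab: "0 \<le> a" "a \<le> b"
  shows "(g has_integral (G b - G a)) {a..b}"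
proof -
  have int: "(g has_integral G t) {0..t}" if "t \<ge> 0" for t
    using Y that unfolding young_function_def by blast
  have "g integrable_on {0..b}"
    using int[of b] ab by auto
  then have "g integrable_on {a..b}"
    by (rule integrable_on_subinterval) (use ab in auto)
  then obtain I where I: "(g has_integral I) {a..b}" by blast
  have "(g has_integral (G a + I)) {0..b}"
    using has_integral_combine[OF ab int I] ab by simp
  then have "G a + I = G b"
    using has_integral_unique[OF _ int[of b]] ab by simp
  then have "I = G b - G a" by simp
  then show ?thesis using I by simp
qed

lemma young_function_zero: "young_function G g \<Longrightarrow> G 0 = 0"
  using has_integral_unique[of g "G 0" "{0..0}" 0] unfolding young_function_def
  by (auto simp: has_integral_refl)

lemma young_function_increment_bounds:
  assumes Y: "young_function G g" and ab: "0 \<le> a" "a \<le> b"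
  shows "(b - a) * g a \<le> G b - G a" and "G b - G a \<le> (b - a) * g b"
proof -
  \<comment> \<open>Monotonicity is given on the open half line; the endpoint is covered by
    \<open>g 0 = 0\<close> and the nonnegativity of g.\<close>
  have g: "g s \<le> g t" if "0 \<le> s" "s \<le> t" for s t
    using Y that unfolding young_function_def mono_on_def
    by (cases "s = 0") (auto simp: less_le)
  note I = young_function_increment[OF Y ab]
  have "((\<lambda>_. g a) has_integral (b - a) * g a) {a..b}"
    using has_integral_const_real[of "g a" a b] ab by simp
  then show "(b - a) * g a \<le> G b - G a"
    by (rule has_integral_le[OF _ I]) (use g ab in auto)
  have "((\<lambda>_. g b) has_integral (b - a) * g b) {a..b}"
    using has_integral_const_real[of "g b" a b] ab by simp
  then show "G b - G a \<le> (b - a) * g b"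
    by (rule has_integral_le[OF I]) (use g ab in auto)
qed

text \<open>The slope of G over [0, l t] is at most g (l t), and the slope over [l t, t] is at least
  g (l t). Comparing the two slopes is the convexity estimate.\<close>

lemma young_function_scale:
  assumes Y: "young_function G g" and l: "0 \<le> l" "l \<le> 1" and t: "0 \<le> t"
  shows "G (l * t) \<le> l * G t"
proof (cases "l = 0 \<or> t = 0")
  case True
  then show ?thesis using young_function_zero[OF Y] by auto
next
  case False
  have lt: "l * t \<le> t" using l t mult_left_le_one_le by blast
  note G0 = young_function_zero[OF Y]
  have "G (l * t) \<le> l * t * g (l * t)"
    using young_function_increment_bounds(2)[OF Y, of 0 "l * t"] l t G0 by simp
  moreover have "(t - l * t) * g (l * t) \<le> G t - G (l * t)"
    using young_function_increment_bounds(1)[OF Y, of "l * t" t] l t lt by simp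
  ultimately have "(1 - l) * G (l * t) \<le> (1 - l) * (l * t * g (l * t))"
      and "l * ((t - l * t) * g (l * t)) \<le> l * (G t - G (l * t))"
    using l by (auto intro: mult_left_mono)
  then show ?thesis by (simp add: algebra_simps)
qed

text \<open>Formally (ln G)' <= pp / t, and integrating over [t, 2 t] would give doubling. The proof
  is a discrete form of this: G at most doubles under a fixed dilation l > 1, and a power of l
  exceeds 2.\<close>

lemma young_function_delta2:
  assumes Y: "young_function G g" and C1: "C1_half_line G"
    and upper: "\<And>t. t > 0 \<Longrightarrow> t * g t / G t \<le> pp"
  shows "delta2_young G"
proof -
  have g: "0 < t \<Longrightarrow> 0 < g t" "0 \<le> t \<Longrightarrow> 0 \<le> g t" for t
    using Y unfolding young_function_def by auto
  note zero = young_function_zero[OF Y]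
  have mono: "G a \<le> G b" if "0 \<le> a" "a \<le> b" for a b
  proof -
    have "0 \<le> (b - a) * g a" using that g(2) by simp
    then show ?thesis using young_function_increment_bounds(1)[OF Y that] by simp
  qed
  have pos: "0 < G t" if "0 < t" for t
  proof -
    have "0 < (t - t / 2) * g (t / 2)" using that g(1)[of "t / 2"] by simp
    then show ?thesis
      using young_function_increment_bounds(1)[OF Y, of "t / 2" t] mono[of 0 "t / 2"] zero that by simp
  qed
  have cont: "continuous_on {0..} G"
    using C1 unfolding C1_half_line_def
    by (auto intro: DERIV_continuous_on)
  \<comment> \<open>\<open>l\<close> solves (l - 1) * 2q = l. The increment of G over [t, l t] is at
    most (l - 1) t g (l t), so 2q times it is at most l t g (l t), hence at most q G (l t). Taking q
    at least 1 keeps the denominator 2q - 1 positive.\<close>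
  define q where "q = max pp 1"
  define l where "l = 2 * q / (2 * q - 1)"
  have q: "1 \<le> q" "pp \<le> q" by (auto simp: q_def)
  have l: "1 < l" using q by (simp add: l_def field_simps)
  have lq: "(l - 1) * (2 * q) = l"
    using q by (simp add: l_def field_simps)
  \<comment> \<open>The ratio l is so close to 1 that the increment of G over [t, l t] absorbs at most half of G (l t).\<close>
  have small: "G (l * t) \<le> 2 * G t" if t: "0 \<le> t" for t
  proof (cases "t = 0")
    case False
    with t l have lt: "0 < l * t" "t \<le> l * t" by auto
    have "l * t * g (l * t) / G (l * t) \<le> q"
      using upper[OF lt(1)] q by simp
    then have h: "l * t * g (l * t) \<le> q * G (l * t)"
      using pos[OF lt(1)] by (simp add: field_simps)
    have "G (l * t) - G t \<le> (l * t - t) * g (l * t)"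
      by (rule young_function_increment_bounds(2)[OF Y t lt(2)])
    then have "2 * q * (G (l * t) - G t) \<le> 2 * q * ((l * t - t) * g (l * t))"
      using q by (intro mult_left_mono) auto
    also have "\<dots> = ((l - 1) * (2 * q)) * t * g (l * t)" by (simp add: algebra_simps)
    also have "\<dots> \<le> q * G (l * t)" using h lq by simp
    finally have "q * (2 * (G (l * t) - G t)) \<le> q * G (l * t)" by (simp add: algebra_simps)
    then have "2 * (G (l * t) - G t) \<le> G (l * t)" using q by simp
    then show ?thesis by simp
  qed (simp add: zero)
  obtain k where k: "2 < l ^ k" using real_arch_pow[OF l] by auto
  have pow: "G (l ^ j * t) \<le> 2 ^ j * G t" if "0 \<le> t" for j t
  proof (induction j)
    case (Suc j)
    have "G (l ^ Suc j * t) \<le> 2 * G (l ^ j * t)"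
      using small[of "l ^ j * t"] that l by (simp add: mult.assoc)
    then show ?case using Suc by simp
  qed simp
  have "G (2 * t) \<le> 2 ^ k * G t" if "0 \<le> t" for t
    using pow[OF that, of k] mono[of "2 * t" "l ^ k * t"] k that mult_right_mono[of 2 "l ^ k" t] by simp
  then have delta2: "\<exists>D>0. \<forall>t\<ge>0. G (2 * t) \<le> D * G t"
    by (intro exI[of _ "2 ^ k"]) auto
  show ?thesis
    by standard (use zero mono pos cont delta2 young_function_scale[OF Y] in auto)
qed

section \<open>The Gagliardo kernel and the comparison with a single value\<close>

text \<open>The integrand of \<open>Phi\<close> with the weight of \<open>mu\<close> absorbed, so
  that the energy becomes an iterated Lebesgue integral and can be localised with
  indicators.\<close>

definition gagliardo :: "real \<Rightarrow> (real \<Rightarrow> real) \<Rightarrow> (real ^ 'n \<Rightarrow> real) \<Rightarrow> real ^ 'n \<Rightarrow> real ^ 'n \<Rightarrow> ennreal" where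
  "gagliardo s G u x y = ennreal (1 / norm (x - y) ^ CARD('n)) * ennreal (G \<bar>D_quot s u x y\<bar>)"

lemma gagliardo_commute: "gagliardo s G u x y = gagliardo s G u y x"
  by (simp add: gagliardo_def D_quot_def norm_minus_commute abs_minus_commute)

lemma gagliardo_translation: "gagliardo s G (\<lambda>x. u (x + a)) x y = gagliardo s G u (x + a) (y + a)"
  by (simp add: gagliardo_def D_quot_def)

interpretation lebesgue: sigma_finite_measure "lebesgue :: 'a::euclidean_space measure"
  by (rule sigma_finite_lebesgue)

interpretation lebesgue_pair: pair_sigma_finite "lebesgue :: 'a::euclidean_space measure" "lebesgue :: 'b::euclidean_space measure" ..

lemma borel_measurable_fst_lebesgue [measurable]:
  "fst \<in> borel_measurable ((lebesgue :: 'a::euclidean_space measure) \<Otimes>\<^sub>M N)"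
  using measurable_compose[OF measurable_fst, of id "lebesgue :: 'a measure" borel N]
  by (simp add: id_borel_measurable_lebesgue)

lemma borel_measurable_snd_lebesgue [measurable]:
  "snd \<in> borel_measurable (M \<Otimes>\<^sub>M (lebesgue :: 'a::euclidean_space measure))"
  using measurable_compose[OF measurable_snd, of id "lebesgue :: 'a measure" borel M]
  by (simp add: id_borel_measurable_lebesgue)

context delta2_young
begin

lemma borel_measurable_eG_comp [measurable (raw)]:
  "f \<in> borel_measurable M \<Longrightarrow> (\<lambda>x. G \<bar>f x\<bar>) \<in> borel_measurable M"
  using measurable_compose[OF _ borel_measurable_G_abs] .

lemma borel_measurable_D_quot:
  fixes u :: "real ^ 'n \<Rightarrow> real"
  assumes [measurable]: "u \<in> borel_measurable lebesgue"
  shows "(\<lambda>(x, y). D_quot s u x y) \<in> borel_measurable (lebesgue \<Otimes>\<^sub>M lebesgue)"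
  unfolding D_quot_def case_prod_beta by measurable

lemma borel_measurable_gagliardo [measurable]:
  fixes u :: "real ^ 'n \<Rightarrow> real"
  assumes [measurable]: "u \<in> borel_measurable lebesgue"
  shows "(\<lambda>(x, y). gagliardo s G u x y) \<in> borel_measurable (lebesgue \<Otimes>\<^sub>M lebesgue)"
  using borel_measurable_D_quot[OF assms, of s]
  unfolding gagliardo_def case_prod_beta by measurable

lemma Phi_eq_iterated:
  fixes u :: "real ^ 'n \<Rightarrow> real"
  assumes [measurable]: "u \<in> borel_measurable lebesgue"
  shows "Phi s G u = (\<integral>\<^sup>+ x. \<integral>\<^sup>+ y. gagliardo s G u x y \<partial>lebesgue \<partial>lebesgue)"
proof -
  note [measurable] = borel_measurable_D_quot[OF assms, of s]
  have "Phi s G u = (\<integral>\<^sup>+ p. (case p of (x, y) \<Rightarrow> gagliardo s G u x y) \<partial>(lebesgue \<Otimes>\<^sub>M lebesgue))"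
    unfolding Phi_def mu_def gagliardo_def
    by (subst nn_integral_density) (auto simp: case_prod_beta intro!: nn_integral_cong)
  then show ?thesis
    using lebesgue.nn_integral_fst[OF borel_measurable_gagliardo[OF assms, of s]] by simp
qed

lemma Phi_translation:
  fixes u :: "real ^ 'n \<Rightarrow> real"
  assumes [measurable]: "u \<in> borel_measurable lebesgue"
  shows "Phi s G (\<lambda>x. u (x + a)) = Phi s G u"
proof -
  have u': "(\<lambda>x. u (x + a)) \<in> borel_measurable lebesgue" by measurable
  have "Phi s G (\<lambda>x. u (x + a)) = (\<integral>\<^sup>+ x. \<integral>\<^sup>+ y. gagliardo s G u (x + a) (y + a) \<partial>lebesgue \<partial>lebesgue)"
    by (simp add: Phi_eq_iterated[OF u'] gagliardo_translation)
  also have "\<dots> = (\<integral>\<^sup>+ x. \<integral>\<^sup>+ y. gagliardo s G u (x + a) y \<partial>lebesgue \<partial>lebesgue)"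
    by (intro nn_integral_cong nn_integral_lebesgue_translation) measurable
  also have "\<dots> = (\<integral>\<^sup>+ x. \<integral>\<^sup>+ y. gagliardo s G u x y \<partial>lebesgue \<partial>lebesgue)"
    by (rule nn_integral_lebesgue_translation[where f = "\<lambda>x. \<integral>\<^sup>+ y. gagliardo s G u x y \<partial>lebesgue"]) measurable
  finally show ?thesis by (simp add: Phi_eq_iterated)
qed

text \<open>For r = |x - y| <= d the difference is r^s times the quotient, hence at most d^s times
  it, and the weight 1 / r^N is at least 1 / d^N. The constant C is left open because d is used in
  two regimes: for d <= 1 convexity allows the small value C = d^s, for large d doubling supplies
  some C.\<close>

lemma eG_diff_le_gagliardo:
  fixes u :: "real ^ 'n \<Rightarrow> real"
  assumes s: "0 < s" and d: "0 < d" and C: "0 \<le> C" "\<And>t. 0 \<le> t \<Longrightarrow> G (d powr s * t) \<le> C * G t"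
    and xy: "norm (x - y) \<le> d"
  shows "eG (u x - u y) \<le> ennreal (d ^ CARD('n) * C) * gagliardo s G u x y"
proof (cases "x = y")
  case True
  then show ?thesis by (simp add: zero)
next
  case False
  define r where "r = norm (x - y)"
  have r: "0 < r" "r \<le> d" using False xy by (auto simp: r_def)
  define D where "D = \<bar>D_quot s u x y\<bar>"
  have D: "0 \<le> D" "\<bar>u x - u y\<bar> = r powr s * D"
    using r by (auto simp: D_def D_quot_def r_def[symmetric])
  have "G \<bar>u x - u y\<bar> \<le> G (d powr s * D)"
    unfolding D(2) using r s D(1) by (intro mono mult_right_mono powr_mono2) auto
  also have "\<dots> \<le> C * G D" using C D by simp
  also have "\<dots> = 1 * (C * G D)" by simp
  also have "\<dots> \<le> (d / r) ^ CARD('n) * (C * G D)"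
    using r C(1) D nonneg[of D] by (intro mult_right_mono one_le_power mult_nonneg_nonneg) auto
  also have "\<dots> = (d ^ CARD('n) * C) * (1 / r ^ CARD('n) * G D)"
    by (simp add: power_divide)
  finally have "eG (u x - u y) \<le> ennreal ((d ^ CARD('n) * C) * (1 / r ^ CARD('n) * G D))"
    by (rule ennreal_leI)
  also have "\<dots> = ennreal (d ^ CARD('n) * C) * gagliardo s G u x y"
    using r d C(1) D(1) nonneg[of D]
    by (subst ennreal_mult) (auto simp: gagliardo_def D_def r_def[symmetric] ennreal_mult[symmetric])
  finally show ?thesis .
qed

text \<open>A Poincare-type inequality with the value \<open>u y\<close> in place of the mean of u:
  the pointwise bound is integrated over A and Q, and some y in A does no worse than the average.
  The indicators stay in the kernel integral so that contributions of disjoint pieces can be added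
  without exceeding \<open>Phi\<close>.\<close>

lemma exists_good_value:
  fixes u :: "real ^ 'n \<Rightarrow> real"
  assumes u[measurable]: "u \<in> borel_measurable lebesgue"
    and s: "0 < s" and d: "0 < d" and C: "0 \<le> C" "\<And>t. 0 \<le> t \<Longrightarrow> G (d powr s * t) \<le> C * G t"
    and A[measurable]: "A \<in> sets lebesgue" and Q[measurable]: "Q \<in> sets lebesgue"
    and A0: "emeasure lebesgue A \<noteq> 0" and Afin: "emeasure lebesgue A \<noteq> \<infinity>"
    and dist: "\<And>x y. x \<in> Q \<Longrightarrow> y \<in> A \<Longrightarrow> norm (x - y) \<le> d"
  shows "\<exists>y\<in>A. emeasure lebesgue A * (\<integral>\<^sup>+ x\<in>Q. eG (u x - u y) \<partial>lebesgue)
    \<le> ennreal (d ^ CARD('n) * C) *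
      (\<integral>\<^sup>+ x. \<integral>\<^sup>+ y. gagliardo s G u x y * indicator A x * indicator Q y \<partial>lebesgue \<partial>lebesgue)"
proof -
  let ?c = "ennreal (d ^ CARD('n) * C)"
  have m: "(\<lambda>y. \<integral>\<^sup>+ x. eG (u x - u y) * indicator Q x \<partial>lebesgue) \<in> borel_measurable lebesgue"
    by measurable
  obtain y where y: "y \<in> A" "emeasure lebesgue A * (\<integral>\<^sup>+ x\<in>Q. eG (u x - u y) \<partial>lebesgue)
      \<le> (\<integral>\<^sup>+ y\<in>A. (\<integral>\<^sup>+ x\<in>Q. eG (u x - u y) \<partial>lebesgue) \<partial>lebesgue)"
    using exists_le_average[OF m A A0 Afin] by blast
  have "(\<integral>\<^sup>+ y\<in>A. (\<integral>\<^sup>+ x\<in>Q. eG (u x - u y) \<partial>lebesgue) \<partial>lebesgue)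
      \<le> (\<integral>\<^sup>+ y. (\<integral>\<^sup>+ x. ?c * (gagliardo s G u y x * indicator A y * indicator Q x) \<partial>lebesgue) \<partial>lebesgue)"
  proof (intro nn_integral_mono)
    fix y
    show "(\<integral>\<^sup>+ x\<in>Q. eG (u x - u y) \<partial>lebesgue) * indicator A y
      \<le> (\<integral>\<^sup>+ x. ?c * (gagliardo s G u y x * indicator A y * indicator Q x) \<partial>lebesgue)"
    proof (cases "y \<in> A")
      case True
      then show ?thesis
        using eG_diff_le_gagliardo[OF s d C dist[OF _ True], of _ u]
        by (auto intro!: nn_integral_mono simp: gagliardo_commute[of s G u y] indicator_def)
    qed auto
  qed
  also have "\<dots> = (\<integral>\<^sup>+ y. ?c * (\<integral>\<^sup>+ x. (gagliardo s G u y x * indicator A y * indicator Q x) \<partial>lebesgue) \<partial>lebesgue)"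
    by (intro nn_integral_cong nn_integral_cmult) measurable
  also have "\<dots> = ?c * (\<integral>\<^sup>+ y. (\<integral>\<^sup>+ x. (gagliardo s G u y x * indicator A y * indicator Q x) \<partial>lebesgue) \<partial>lebesgue)"
    by (intro nn_integral_cmult) measurable
  finally show ?thesis
    using y by (blast intro: order_trans)
qed

end

section \<open>The grid of cubes of side 1/K\<close>

text \<open>Indices are integer-valued functions on the finite index type, hence form a countable
  type, as the diagonal argument requires.\<close>

definition cell :: "nat \<Rightarrow> real ^ 'n \<Rightarrow> 'n \<Rightarrow> int" where
  "cell K x = (\<lambda>i. \<lfloor>real K * x $ i\<rfloor>)"

text \<open>As fibres of \<open>cell\<close>, the half-open cubes are pairwise disjoint and cover
  the space without further proof.\<close>

definition cube :: "nat \<Rightarrow> ('n \<Rightarrow> int) \<Rightarrow> (real ^ 'n) set" where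
  "cube K z = {x. cell K x = z}"

lemma mem_cube_iff:
  assumes "0 < K"
  shows "x \<in> cube K z \<longleftrightarrow> (\<forall>i. of_int (z i) / real K \<le> x $ i \<and> x $ i < (of_int (z i) + 1) / real K)"
  using assms by (auto simp: cube_def cell_def fun_eq_iff floor_eq_iff field_simps)

lemma cube_borel: "0 < K \<Longrightarrow> cube K z \<in> sets (borel :: (real ^ 'n::finite) measure)"
proof -
  assume K: "0 < K"
  have "cube K z = (\<Inter>i. {x. of_int (z i) / real K \<le> x $ i} \<inter> {x. x $ i < (of_int (z i) + 1) / real K})"
    using mem_cube_iff[OF K] by auto
  also have "\<dots> \<in> sets borel"
    by (intro sets.countable_INT'' sets.Int borel_closed borel_open closed_Collect_le open_Collect_less continuous_intros) auto
  finally show ?thesis .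
qed

text \<open>The half-open cube lies between an open and a closed box of equal measure.\<close>

lemma emeasure_cube:
  fixes z :: "'n::finite \<Rightarrow> int"
  assumes "0 < K"
  shows "emeasure lebesgue (cube K z) = ennreal ((1 / real K) ^ CARD('n))"
proof -
  define a b :: "real ^ 'n" where "a = (\<chi> i. of_int (z i) / real K)" and "b = (\<chi> i. (of_int (z i) + 1) / real K)"
  have ba: "b $ i - a $ i = 1 / real K" for i by (simp add: a_def b_def add_divide_distrib)
  have le: "a $ i \<le> b $ i" for i using assms by (simp add: a_def b_def divide_right_mono)
  have c: "measure lborel (cbox a b) = (1 / real K) ^ CARD('n)"
    by (subst content_cbox_cart) (auto simp: ba interval_ne_empty_cart le)
  have sub: "box a b \<subseteq> cube K z" "cube K z \<subseteq> cbox a b"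
    using assms by (auto simp: subset_iff mem_cube_iff mem_box_cart a_def b_def less_imp_le)
  have cb: "emeasure lebesgue (cbox a b) = ennreal ((1 / real K) ^ CARD('n))"
    using emeasure_eq_ennreal_measure[of lborel "cbox a b"] emeasure_bounded_finite[of "cbox a b"] c
    by simp
  have "emeasure lebesgue (box a b) = emeasure lebesgue (cbox a b)"
    using le by (simp add: emeasure_lborel_box_eq emeasure_lborel_cbox_eq)
  then show ?thesis
    using emeasure_mono[OF sub(1), of lebesgue] emeasure_mono[OF sub(2), of lebesgue] cube_borel[OF assms, of z] cb
    by (auto intro!: antisym)
qed

lemma norm_diff_cube_le:
  fixes x y :: "real ^ 'n::finite"
  assumes "0 < K" "x \<in> cube K z" "y \<in> cube K z"
  shows "norm (x - y) \<le> real CARD('n) / real K"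
proof -
  have "norm (x - y) \<le> (\<Sum>i\<in>UNIV. \<bar>(x - y) $ i\<bar>)" by (rule norm_le_l1_cart)
  also have "\<dots> \<le> (\<Sum>i\<in>(UNIV::'n set). 1 / real K)"
  proof (rule sum_mono)
    fix i
    show "\<bar>(x - y) $ i\<bar> \<le> 1 / real K"
      using assms(2,3) mem_cube_iff[OF assms(1), of x z] mem_cube_iff[OF assms(1), of y z]
      by (auto simp: abs_le_iff add_divide_distrib dest!: spec[of _ i])
  qed
  finally show ?thesis by simp
qed

lemma finite_cell_image:
  fixes S :: "(real ^ 'n::finite) set"
  assumes "bounded S"
  shows "finite (cell K ` S)"
proof -
  obtain B where B: "\<And>x. x \<in> S \<Longrightarrow> norm x \<le> B" using assms by (auto simp: bounded_iff)
  have "cell K ` S \<subseteq> PiE UNIV (\<lambda>_. {\<lfloor>- (real K * B)\<rfloor>..\<lfloor>real K * B\<rfloor>})"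
  proof (intro image_subsetI PiE_I)
    fix x i assume "x \<in> S"
    then have "\<bar>x $ i\<bar> \<le> B" using B component_le_norm_cart order_trans by blast
    then have "real K * \<bar>x $ i\<bar> \<le> real K * B" by (rule mult_left_mono) simp
    then have "\<bar>real K * x $ i\<bar> \<le> real K * B" by (simp add: abs_mult)
    then have "- (real K * B) \<le> real K * x $ i" "real K * x $ i \<le> real K * B"
      by linarith+
    then show "cell K x i \<in> {\<lfloor>- (real K * B)\<rfloor>..\<lfloor>real K * B\<rfloor>}"
      by (simp add: cell_def floor_mono)
  qed auto
  then show ?thesis
    by (rule finite_subset) (auto intro: finite_PiE)
qed

section \<open>Approximation by step functions\<close>

context delta2_young
begin

text \<open>On each cube the comparison value comes from \<open>exists_good_value\<close> with A and
  Q both equal to the cube. Dividing d^N * d^s by the volume K^(-N) leaves N^N * d^s, where d = N /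
  K. The constants are chosen before \<Omega>, and the bound does not depend on \<Omega>.\<close>

lemma step_approximation:
  fixes u :: "real ^ 'n \<Rightarrow> real"
  assumes u[measurable]: "u \<in> borel_measurable lebesgue" and s: "0 < s" and K: "CARD('n) \<le> K"
  shows "\<exists>c. \<forall>\<Omega>. bounded \<Omega> \<longrightarrow> (\<integral>\<^sup>+ x\<in>\<Omega>. eG (u x - c (cell K x)) \<partial>lebesgue)
    \<le> ennreal (real CARD('n) ^ CARD('n) * (real CARD('n) / real K) powr s) * Phi s G u"
proof -
  define N where "N = CARD('n)"
  define d where "d = real N / real K"
  define J where "J z = (\<integral>\<^sup>+ x. \<integral>\<^sup>+ y. gagliardo s G u x y * indicator (cube K z) x * indicator (cube K z) y \<partial>lebesgue \<partial>lebesgue)" for z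
  have N: "0 < N" by (simp add: N_def)
  have K0: "0 < K" using K N N_def by linarith
  have d: "0 < d" "d \<le> 1" using K K0 N by (auto simp: d_def N_def)
  have [measurable]: "cube K z \<in> sets lebesgue" for z :: "'n \<Rightarrow> int"
    using cube_borel[OF K0, of z] by simp
  \<comment> \<open>This is where the error becomes small: d <= 1 lets convexity pull the factor d^s
    out of G.\<close>
  have scal: "G (d powr s * t) \<le> d powr s * G t" if "0 \<le> t" for t
    using d s that by (intro scale) (auto simp: powr_le1)
  have "\<exists>c. (\<integral>\<^sup>+ x\<in>cube K z. eG (u x - c) \<partial>lebesgue) \<le> ennreal (real N ^ N * d powr s) * J z" for z
  proof -
    obtain y where y: "ennreal ((1 / real K) ^ N) * (\<integral>\<^sup>+ x\<in>cube K z. eG (u x - u y) \<partial>lebesgue)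
       \<le> ennreal (d ^ N * d powr s) * J z"
      using exists_good_value[OF u s d(1) _ scal, where A = "cube K z" and Q = "cube K z"] norm_diff_cube_le[OF K0]
      by (auto simp: emeasure_cube[OF K0] d_def N_def J_def K0)
    have "(\<integral>\<^sup>+ x\<in>cube K z. eG (u x - u y) \<partial>lebesgue) =
        ennreal (real K ^ N) * (ennreal ((1 / real K) ^ N) * (\<integral>\<^sup>+ x\<in>cube K z. eG (u x - u y) \<partial>lebesgue))"
      using K0 by (simp add: mult.assoc[symmetric] ennreal_mult[symmetric] power_divide)
    also have "\<dots> \<le> ennreal (real K ^ N) * (ennreal (d ^ N * d powr s) * J z)"
      using y by (rule mult_left_mono) simp
    also have "\<dots> = ennreal (real N ^ N * d powr s) * J z"
      using K0 by (simp add: mult.assoc[symmetric] ennreal_mult[symmetric] d_def power_divide)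
    finally show ?thesis by blast
  qed
  then obtain c where c: "(\<integral>\<^sup>+ x\<in>cube K z. eG (u x - c z) \<partial>lebesgue) \<le> ennreal (real N ^ N * d powr s) * J z" for z
    by metis
  \<comment> \<open>\<open>J z\<close> is the energy on the diagonal block cube times cube.
    Different blocks are disjoint, so each pair (x, y) is counted at most once.\<close>
  have sumJ: "(\<Sum>z\<in>Z. J z) \<le> Phi s G u" if Z: "finite Z" for Z
  proof -
    have "(\<Sum>z\<in>Z. J z) = (\<integral>\<^sup>+ x. (\<Sum>z\<in>Z. \<integral>\<^sup>+ y. gagliardo s G u x y * indicator (cube K z) x * indicator (cube K z) y \<partial>lebesgue) \<partial>lebesgue)"
      unfolding J_def by (rule nn_integral_sum[symmetric]) measurable
    also have "\<dots> = (\<integral>\<^sup>+ x. (\<integral>\<^sup>+ y. (\<Sum>z\<in>Z. gagliardo s G u x y * indicator (cube K z) x * indicator (cube K z) y) \<partial>lebesgue) \<partial>lebesgue)"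
      by (intro nn_integral_cong nn_integral_sum[symmetric]) measurable
    also have "\<dots> \<le> (\<integral>\<^sup>+ x. (\<integral>\<^sup>+ y. gagliardo s G u x y \<partial>lebesgue) \<partial>lebesgue)"
    proof (intro nn_integral_mono)
      fix x y
      have "(\<Sum>z\<in>Z. gagliardo s G u x y * indicator (cube K z) x * indicator (cube K z) y)
          \<le> (\<Sum>z\<in>Z. if z = cell K x then gagliardo s G u x y else 0)"
        by (intro sum_mono) (auto simp: indicator_def cube_def)
      also have "\<dots> \<le> gagliardo s G u x y" using Z by simp
      finally show "(\<Sum>z\<in>Z. gagliardo s G u x y * indicator (cube K z) x * indicator (cube K z) y) \<le> gagliardo s G u x y" .
    qed
    finally show ?thesis by (simp add: Phi_eq_iterated)
  qed
  have "(\<integral>\<^sup>+ x\<in>\<Omega>. eG (u x - c (cell K x)) \<partial>lebesgue) \<le> ennreal (real N ^ N * d powr s) * Phi s G u"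
    if "bounded \<Omega>" for \<Omega>
  proof -
    define Z where "Z = cell K ` \<Omega>"
    have Z: "finite Z" unfolding Z_def by (rule finite_cell_image[OF that])
    have "(\<integral>\<^sup>+ x\<in>\<Omega>. eG (u x - c (cell K x)) \<partial>lebesgue)
        \<le> (\<integral>\<^sup>+ x. (\<Sum>z\<in>Z. eG (u x - c z) * indicator (cube K z) x) \<partial>lebesgue)"
    proof (intro nn_integral_mono)
      fix x
      show "eG (u x - c (cell K x)) * indicator \<Omega> x \<le> (\<Sum>z\<in>Z. eG (u x - c z) * indicator (cube K z) x)"
      proof (cases "x \<in> \<Omega>")
        case True
        then have "cell K x \<in> Z" by (simp add: Z_def)
        from member_le_sum[OF this _ Z, of "\<lambda>z. eG (u x - c z) * indicator (cube K z) x"]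
        show ?thesis using True by (simp add: cube_def)
      qed simp
    qed
    also have "\<dots> = (\<Sum>z\<in>Z. \<integral>\<^sup>+ x\<in>cube K z. eG (u x - c z) \<partial>lebesgue)"
      by (rule nn_integral_sum) measurable
    also have "\<dots> \<le> (\<Sum>z\<in>Z. ennreal (real N ^ N * d powr s) * J z)"
      by (intro sum_mono c)
    also have "\<dots> \<le> ennreal (real N ^ N * d powr s) * Phi s G u"
      unfolding sum_distrib_left[symmetric] by (intro mult_left_mono sumJ Z) auto
    finally show ?thesis .
  qed
  then show ?thesis unfolding N_def d_def by blast
qed

section \<open>Local completeness in the modular\<close>

text \<open>The Riesz-Fischer argument with the modular in place of a norm: a fast subsequence
  converges almost everywhere by Borel-Cantelli, and Fatou's lemma transfers the Cauchy bound to the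
  limit.\<close>

lemma complete_eG:
  fixes w :: "nat \<Rightarrow> 'a::euclidean_space \<Rightarrow> real"
  assumes w[measurable]: "\<And>k. w k \<in> borel_measurable lebesgue"
    and Cauchy: "\<And>m e. 0 < e \<Longrightarrow> \<exists>N. \<forall>j\<ge>N. \<forall>k\<ge>N. (\<integral>\<^sup>+ x\<in>ball 0 (real m). eG (w j x - w k x) \<partial>lebesgue) \<le> ennreal e"
  shows "\<exists>v\<in>borel_measurable lebesgue. \<forall>m. \<forall>e>0. \<exists>N. \<forall>k\<ge>N.
    (\<integral>\<^sup>+ x\<in>ball 0 (real m). eG (w k x - v x) \<partial>lebesgue) \<le> ennreal e"
proof -
  define h :: "nat \<Rightarrow> real" where "h j = (1 / 2) ^ j" for j
  have h: "0 < h j" for j by (simp add: h_def)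
  have h_sum: "summable h" unfolding h_def by (rule summable_geometric) simp
  have Gh: "0 < G (h j)" for j using pos h by simp
  \<comment> \<open>The bound is the one Chebyshev's inequality asks for: differences of size at
    least \<open>h j\<close> then occupy measure at most \<open>h j\<close>, which is
    summable.\<close>
  have "\<forall>j. \<exists>N. \<forall>a\<ge>N. \<forall>b\<ge>N. (\<integral>\<^sup>+ x\<in>ball 0 (real j). eG (w a x - w b x) \<partial>lebesgue) \<le> ennreal (G (h j) * h j)"
    using Cauchy h Gh by (metis mult_pos_pos)
  then obtain N where N: "\<And>j a b. N j \<le> a \<Longrightarrow> N j \<le> b \<Longrightarrow>
      (\<integral>\<^sup>+ x\<in>ball 0 (real j). eG (w a x - w b x) \<partial>lebesgue) \<le> ennreal (G (h j) * h j)"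
    by metis
  \<comment> \<open>The sum puts both \<open>r j\<close> and \<open>r (Suc j)\<close> above
    \<open>N j\<close>; the summand j makes r tend to infinity, as needed in the Fatou step.\<close>
  define r where "r j = j + (\<Sum>i\<le>j. N i)" for j
  have rN: "N j \<le> r j" "N j \<le> r (Suc j)" for j
    using member_le_sum[of j "{..j}" N] by (auto simp: r_def)
  have rj: "j \<le> r j" for j by (simp add: r_def)
  define A where "A j = {x \<in> ball 0 (real j). h j \<le> \<bar>w (r (Suc j)) x - w (r j) x\<bar>}" for j
  have ball[measurable]: "ball 0 (real j) \<in> sets (lebesgue :: 'a measure)" for j by simp
  have A[measurable]: "A j \<in> sets lebesgue" for j
  proof -
    have "A j = ball 0 (real j) \<inter> {x \<in> space lebesgue. h j \<le> \<bar>w (r (Suc j)) x - w (r j) x\<bar>}"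
      by (auto simp: A_def)
    also have "\<dots> \<in> sets lebesgue" by measurable
    finally show ?thesis .
  qed
  have emA: "emeasure lebesgue (A j) \<le> ennreal (h j)" for j
  proof -
    have "ennreal (G (h j)) * emeasure lebesgue (A j) = (\<integral>\<^sup>+ x\<in>A j. ennreal (G (h j)) \<partial>lebesgue)"
      by (simp add: nn_integral_cmult_indicator)
    also have "\<dots> \<le> (\<integral>\<^sup>+ x\<in>ball 0 (real j). eG (w (r (Suc j)) x - w (r j) x) \<partial>lebesgue)"
      using h[of j] by (intro nn_integral_mono) (auto simp: A_def indicator_def intro!: ennreal_leI mono)
    also have "\<dots> \<le> ennreal (G (h j) * h j)" by (rule N[OF rN(2) rN(1)])
    also have "\<dots> = ennreal (G (h j)) * ennreal (h j)"
      using h Gh by (simp add: ennreal_mult less_imp_le)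
    finally have "ennreal (G (h j)) * emeasure lebesgue (A j) \<le> ennreal (G (h j)) * ennreal (h j)" .
    moreover have "ennreal (G (h j)) \<noteq> 0"
      using Gh[of j] by simp
    ultimately show ?thesis
      by (simp add: ennreal_mult_le_mult_iff)
  qed
  have "AE x in lebesgue. eventually (\<lambda>j. x \<in> space lebesgue - A j) sequentially"
  proof (rule borel_cantelli_AE1[OF A])
    show "emeasure lebesgue (A j) < \<infinity>" for j
      using le_less_trans[OF emA[of j] ennreal_less_top] by simp
    have "norm (measure lebesgue (A j)) \<le> h j" for j
      using enn2real_leI[OF less_imp_le[OF h] emA[of j]] by (simp add: measure_def)
    then show "summable (\<lambda>j. measure lebesgue (A j))"
      by (rule summable_comparison_test'[OF h_sum, where N = 0])
  qed
  then have conv: "AE x in lebesgue. convergent (\<lambda>j. w (r j) x)"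
  proof eventually_elim
    fix x assume "eventually (\<lambda>j. x \<in> space lebesgue - A j) sequentially"
    \<comment> \<open>\<open>A j\<close> controls the differences only inside the ball of radius j,
      but a fixed x belongs to that ball from some j on.\<close>
    moreover have "eventually (\<lambda>j. x \<in> ball 0 (real j)) sequentially"
      using filterlim_real_sequentially unfolding filterlim_at_top_dense by (simp add: dist_norm)
    ultimately have "eventually (\<lambda>j. norm (w (r (Suc j)) x - w (r j) x) \<le> h j) sequentially"
      by eventually_elim (auto simp: A_def)
    then have "summable (\<lambda>j. w (r (Suc j)) x - w (r j) x)"
      using h_sum by (rule summable_comparison_test_ev)
    then have "convergent (\<lambda>n. \<Sum>j<n. w (r (Suc j)) x - w (r j) x)"
      by (simp add: summable_iff_convergent)
    then have "convergent (\<lambda>n. w (r n) x - w (r 0) x)"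
      by (simp only: sum_lessThan_telescope[of "\<lambda>j. w (r j) x"])
    then have "convergent (\<lambda>n. (w (r n) x - w (r 0) x) + w (r 0) x)"
      by (intro convergent_add convergent_const)
    then show "convergent (\<lambda>n. w (r n) x)" by simp
  qed
  \<comment> \<open>On the null set without convergence \<open>lim\<close> is one fixed unspecified
    value, so v is still measurable.\<close>
  define v where "v x = lim (\<lambda>j. w (r j) x)" for x
  have v[measurable]: "v \<in> borel_measurable lebesgue"
    unfolding v_def by (rule borel_measurable_lim_metric) simp
  have lim: "AE x in lebesgue. (\<lambda>j. w (r j) x) \<longlonglongrightarrow> v x"
    using conv by eventually_elim (simp add: v_def convergent_LIMSEQ_iff)
  have "\<exists>N. \<forall>k\<ge>N. (\<integral>\<^sup>+ x\<in>ball 0 (real m). eG (w k x - v x) \<partial>lebesgue) \<le> ennreal e"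
    if e: "0 < e" for m e
  proof -
    obtain M where M: "\<And>j k. M \<le> j \<Longrightarrow> M \<le> k \<Longrightarrow>
        (\<integral>\<^sup>+ x\<in>ball 0 (real m). eG (w j x - w k x) \<partial>lebesgue) \<le> ennreal e"
      using Cauchy[OF e] by blast
    have "(\<integral>\<^sup>+ x\<in>ball 0 (real m). eG (w k x - v x) \<partial>lebesgue) \<le> ennreal e" if k: "M \<le> k" for k
    proof -
      have "(\<integral>\<^sup>+ x\<in>ball 0 (real m). eG (w k x - v x) \<partial>lebesgue)
          = (\<integral>\<^sup>+ x. liminf (\<lambda>j. eG (w k x - w (r j) x) * indicator (ball 0 (real m)) x) \<partial>lebesgue)"
      proof (rule nn_integral_cong_AE)
        show "AE x in lebesgue. eG (w k x - v x) * indicator (ball 0 (real m)) x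
            = liminf (\<lambda>j. eG (w k x - w (r j) x) * indicator (ball 0 (real m)) x)"
          using lim
        proof eventually_elim
          fix x assume "(\<lambda>j. w (r j) x) \<longlonglongrightarrow> v x"
          then have "(\<lambda>j. w k x - w (r j) x) \<longlonglongrightarrow> w k x - v x"
            by (intro tendsto_intros)
          then have "(\<lambda>j. G \<bar>w k x - w (r j) x\<bar>) \<longlonglongrightarrow> G \<bar>w k x - v x\<bar>"
            using continuous_on_tendsto_compose[OF continuous_on_G_abs] by fastforce
          then have "(\<lambda>j. eG (w k x - w (r j) x) * indicator (ball 0 (real m)) x)
              \<longlonglongrightarrow> eG (w k x - v x) * indicator (ball 0 (real m)) x"
            by (cases "x \<in> ball 0 (real m)") (auto simp: nonneg intro!: tendsto_ennrealI)
          then show "eG (w k x - v x) * indicator (ball 0 (real m)) x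
              = liminf (\<lambda>j. eG (w k x - w (r j) x) * indicator (ball 0 (real m)) x)"
            by (simp add: lim_imp_Liminf)
        qed
      qed
      \<comment> \<open>Fatou's lemma in the index j, with k fixed; every term with j at least M is
        already bounded by e.\<close>
      also have "\<dots> \<le> liminf (\<lambda>j. \<integral>\<^sup>+ x\<in>ball 0 (real m). eG (w k x - w (r j) x) \<partial>lebesgue)"
        by (rule nn_integral_liminf) measurable
      also have "\<dots> \<le> ennreal e"
      proof (rule Liminf_le)
        show "\<forall>\<^sub>F j in sequentially. (\<integral>\<^sup>+ x\<in>ball 0 (real m). eG (w k x - w (r j) x) \<partial>lebesgue) \<le> ennreal e"
          using eventually_ge_at_top[of M]
          by eventually_elim (use M[OF k] rj in \<open>meson order_trans\<close>)
      qed simp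
      finally show ?thesis .
    qed
    then show ?thesis by blast
  qed
  with v show ?thesis by blast
qed

section \<open>Extraction of a locally Cauchy subsequence\<close>

text \<open>On the cube the constant is the difference of v n and the approximation error, both
  bounded in modular uniformly in n. Dividing by the volume of the cube bounds G of the constant,
  hence the constant.\<close>

lemma cell_constants_bounded:
  fixes v :: "nat \<Rightarrow> real ^ 'n \<Rightarrow> real"
  assumes v[measurable]: "\<And>n. v n \<in> borel_measurable lebesgue"
    and bdd: "\<And>m. \<exists>B. \<forall>n. (\<integral>\<^sup>+ x\<in>ball 0 (real m). eG (v n x) \<partial>lebesgue) \<le> ennreal B"
    and K: "0 < K"
    and c: "\<And>n \<Omega>. bounded \<Omega> \<Longrightarrow> (\<integral>\<^sup>+ x\<in>\<Omega>. eG (v n x - c n (cell K x)) \<partial>lebesgue) \<le> ennreal X"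
  shows "\<exists>b>0. \<forall>n. \<bar>c n z\<bar> \<le> b"
proof -
  have "bounded (cube K z)"
    unfolding bounded_two_points using norm_diff_cube_le[OF K, of _ z] by (auto simp: dist_norm)
  then obtain m where m: "cube K z \<subseteq> ball 0 (real m)"
    by (metis bounded_subset_ballD order_trans real_arch_simple subset_ball)
  obtain B where B: "\<And>n. (\<integral>\<^sup>+ x\<in>ball 0 (real m). eG (v n x) \<partial>lebesgue) \<le> ennreal B"
    using bdd by blast
  obtain D where D: "D > 0" "\<And>x y. eG (x + y) \<le> ennreal D * (eG x + eG y)"
    using eG_add by blast
  \<comment> \<open>X and B are arbitrary reals and \<open>ennreal\<close> truncates negative ones
    to 0, hence the maxima. The power of K is the reciprocal volume of the cube.\<close>
  define Y where "Y = D * (max 0 X + max 0 B) * real K ^ CARD('n)"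
  have [measurable]: "cube K z \<in> sets lebesgue"
    using cube_borel[OF K, of z] by simp
  have "G \<bar>c n z\<bar> \<le> Y" for n
  proof -
    have "ennreal ((1 / real K) ^ CARD('n)) * eG (c n z) = (\<integral>\<^sup>+ x\<in>cube K z. eG (c n z) \<partial>lebesgue)"
      by (subst nn_integral_cmult_indicator) (simp_all add: emeasure_cube[OF K] mult.commute)
    also have "\<dots> \<le> (\<integral>\<^sup>+ x. ennreal D * (eG (v n x - c n z) * indicator (cube K z) x + eG (v n x) * indicator (cube K z) x) \<partial>lebesgue)"
    proof (intro nn_integral_mono)
      fix x
      show "eG (c n z) * indicator (cube K z) x \<le> ennreal D * (eG (v n x - c n z) * indicator (cube K z) x + eG (v n x) * indicator (cube K z) x)"
        using D(2)[of "c n z - v n x" "v n x"] by (auto simp: indicator_def abs_minus_commute)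
    qed
    also have "\<dots> = ennreal D * ((\<integral>\<^sup>+ x\<in>cube K z. eG (v n x - c n z) \<partial>lebesgue) + (\<integral>\<^sup>+ x\<in>cube K z. eG (v n x) \<partial>lebesgue))"
      by (subst nn_integral_cmult, measurable, subst nn_integral_add) auto
    also have "\<dots> \<le> ennreal D * (ennreal (max 0 X) + ennreal (max 0 B))"
    proof (intro mult_left_mono add_mono)
      have "(\<integral>\<^sup>+ x\<in>cube K z. eG (v n x - c n z) \<partial>lebesgue) = (\<integral>\<^sup>+ x\<in>cube K z. eG (v n x - c n (cell K x)) \<partial>lebesgue)"
        by (intro nn_integral_cong) (auto simp: cube_def indicator_def)
      also have "\<dots> \<le> ennreal (max 0 X)"
        using c[OF \<open>bounded (cube K z)\<close>, of n] by (rule order_trans) (auto intro: ennreal_leI)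
      finally show "(\<integral>\<^sup>+ x\<in>cube K z. eG (v n x - c n z) \<partial>lebesgue) \<le> ennreal (max 0 X)" .
      have "(\<integral>\<^sup>+ x\<in>cube K z. eG (v n x) \<partial>lebesgue) \<le> (\<integral>\<^sup>+ x\<in>ball 0 (real m). eG (v n x) \<partial>lebesgue)"
        using m by (intro nn_integral_mono) (auto simp: indicator_def)
      also have "\<dots> \<le> ennreal (max 0 B)"
        using B[of n] by (rule order_trans) (auto intro: ennreal_leI)
      finally show "(\<integral>\<^sup>+ x\<in>cube K z. eG (v n x) \<partial>lebesgue) \<le> ennreal (max 0 B)" .
    qed simp
    finally have *: "ennreal ((1 / real K) ^ CARD('n)) * eG (c n z) \<le> ennreal D * (ennreal (max 0 X) + ennreal (max 0 B))" .
    have "eG (c n z) = ennreal (real K ^ CARD('n)) * (ennreal ((1 / real K) ^ CARD('n)) * eG (c n z))"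
      using K by (simp add: mult.assoc[symmetric] ennreal_mult[symmetric] power_divide)
    also have "\<dots> \<le> ennreal (real K ^ CARD('n)) * (ennreal D * (ennreal (max 0 X) + ennreal (max 0 B)))"
      using * by (rule mult_left_mono) simp
    also have "\<dots> = ennreal Y"
      using D(1) by (simp add: Y_def ennreal_mult[symmetric] ennreal_plus[symmetric] mult.commute del: ennreal_plus)
    finally show ?thesis
      using D(1) by (subst (asm) ennreal_le_iff) (auto simp: Y_def)
  qed
  then have "\<bar>c n z\<bar> \<le> max 1 (Y / G 1)" for n
    by (rule abs_le_of_G_le)
  then show ?thesis
    by (intro exI[of _ "max 1 (Y / G 1)"]) auto
qed

lemma eG_Cauchy_subsequence:
  fixes v :: "nat \<Rightarrow> real ^ 'n \<Rightarrow> real"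
  assumes v[measurable]: "\<And>n. v n \<in> borel_measurable lebesgue" and s: "0 < s"
    and P: "\<And>n. Phi s G (v n) \<le> ennreal P" "0 \<le> P"
    and bdd: "\<And>m. \<exists>B. \<forall>n. (\<integral>\<^sup>+ x\<in>ball 0 (real m). eG (v n x) \<partial>lebesgue) \<le> ennreal B"
  shows "\<exists>r :: nat \<Rightarrow> nat. strict_mono r \<and> (\<forall>m. \<forall>e>0. \<exists>M. \<forall>j\<ge>M. \<forall>k\<ge>M.
    (\<integral>\<^sup>+ x\<in>ball 0 (real m). eG (v (r j) x - v (r k) x) \<partial>lebesgue) \<le> ennreal e)"
proof -
  define N where "N = CARD('n)"
  have N: "0 < N" by (simp add: N_def)
  define X where "X K = real N ^ N * (real N / real K) powr s * P" for K
  have X0: "0 \<le> X K" for K using P(2) by (simp add: X_def)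
  have "\<exists>c. \<forall>\<Omega>. bounded \<Omega> \<longrightarrow> (\<integral>\<^sup>+ x\<in>\<Omega>. eG (v n x - c (cell K x)) \<partial>lebesgue) \<le> ennreal (X K)" if "N \<le> K" for n K
  proof -
    obtain c where c: "\<And>\<Omega>. bounded \<Omega> \<Longrightarrow> (\<integral>\<^sup>+ x\<in>\<Omega>. eG (v n x - c (cell K x)) \<partial>lebesgue)
        \<le> ennreal (real N ^ N * (real N / real K) powr s) * Phi s G (v n)"
      using step_approximation[OF v s, of K n] \<open>N \<le> K\<close> unfolding N_def by blast
    have "ennreal (real N ^ N * (real N / real K) powr s) * Phi s G (v n) \<le> ennreal (X K)"
      unfolding X_def using P by (subst ennreal_mult) (auto intro!: mult_left_mono)
    then show ?thesis using c by (blast intro: order_trans)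
  qed
  then have "\<forall>n K. \<exists>c. N \<le> K \<longrightarrow> (\<forall>\<Omega>. bounded \<Omega> \<longrightarrow> (\<integral>\<^sup>+ x\<in>\<Omega>. eG (v n x - c (cell K x)) \<partial>lebesgue) \<le> ennreal (X K))"
    by blast
  then obtain c where "\<forall>n K. N \<le> K \<longrightarrow> (\<forall>\<Omega>. bounded \<Omega> \<longrightarrow> (\<integral>\<^sup>+ x\<in>\<Omega>. eG (v n x - c n K (cell K x)) \<partial>lebesgue) \<le> ennreal (X K))"
    unfolding choice_iff by blast
  then have c: "(\<integral>\<^sup>+ x\<in>\<Omega>. eG (v n x - c n K (cell K x)) \<partial>lebesgue) \<le> ennreal (X K)"
    if "N \<le> K" "bounded \<Omega>" for n K \<Omega>
    using that by blast
  have "\<exists>b>0. \<forall>n. \<bar>c n K z\<bar> \<le> b" if "N \<le> K" for K z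
    by (rule cell_constants_bounded[where K = K and v = v and X = "X K" and c = "\<lambda>n. c n K"])
      (use v bdd c that N in auto)
  then obtain b where b: "\<And>K z. N \<le> K \<Longrightarrow> 0 < b K z" "\<And>K z n. N \<le> K \<Longrightarrow> \<bar>c n K z\<bar> \<le> b K z"
    by metis
  \<comment> \<open>The diagonal selection takes one bound for all indices (K, z), whereas
    \<open>b\<close> varies with them; dividing by \<open>b K z\<close> normalises every bound to 1,
    and the division is undone after the limit.\<close>
  have bdd1: "norm (c n (fst p) (snd p) / b (fst p) (snd p)) \<le> 1" if "p \<in> {N..} \<times> UNIV" for n p
    using that b(1)[of "fst p" "snd p"] b(2)[of "fst p" n "snd p"] by auto
  obtain r where r: "strict_mono (r :: nat \<Rightarrow> nat)"
    and "\<And>p. p \<in> {N..} \<times> (UNIV :: ('n \<Rightarrow> int) set) \<Longrightarrow>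
      \<exists>l. (\<lambda>n. c (r n) (fst p) (snd p) / b (fst p) (snd p)) \<longlonglongrightarrow> l"
    using function_convergent_subsequence[where f = "\<lambda>n p. c n (fst p) (snd p) / b (fst p) (snd p)"
        and S = "{N..} \<times> UNIV" and M = 1] bdd1 by (metis countableI_type)
  then have lim: "\<exists>l. (\<lambda>n. c (r n) K z / b K z) \<longlonglongrightarrow> l" if "N \<le> K" for K z
    using that by (metis SigmaI UNIV_I atLeast_iff fst_conv snd_conv)
  have "\<exists>l. (\<lambda>n. c (r n) K z) \<longlonglongrightarrow> l" if K: "N \<le> K" for K z
  proof -
    obtain l where "(\<lambda>n. c (r n) K z / b K z) \<longlonglongrightarrow> l" using lim[OF K] by blast
    then have "(\<lambda>n. c (r n) K z / b K z * b K z) \<longlonglongrightarrow> l * b K z"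
      by (intro tendsto_intros)
    then show ?thesis using b(1)[OF K, of z] by auto
  qed
  then obtain L where L: "\<And>K z. N \<le> K \<Longrightarrow> (\<lambda>n. c (r n) K z) \<longlonglongrightarrow> L K z"
    by metis
  obtain D where D: "D > 0" "\<And>x y. eG (x + y) \<le> ennreal D * (eG x + eG y)"
    using eG_add by blast
  have cau: "\<exists>M. \<forall>j\<ge>M. \<forall>k\<ge>M. (\<integral>\<^sup>+ x\<in>ball 0 (real m). eG (v (r j) x - v (r k) x) \<partial>lebesgue) \<le> ennreal e"
    if e: "0 < e" for m e
  proof -
    \<comment> \<open>The difference is split in three by two uses of \<open>eG_add\<close>: the
      first approximation error costs D, the middle term and the second error cost D * D. Hence the
      errors get (D + D * D) * X K < e / 2, and the middle term gets the other half.\<close>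
    have "(\<lambda>K. (D + D * D) * X K) \<longlonglongrightarrow> 0"
      unfolding X_def using s N by real_asymp
    then have "eventually (\<lambda>K. (D + D * D) * X K < e / 2) sequentially"
      using e by (intro order_tendstoD(2)) auto
    then have "eventually (\<lambda>K. (D + D * D) * X K < e / 2 \<and> N \<le> K) sequentially"
      using eventually_ge_at_top[of N] by eventually_elim auto
    then obtain K where K: "(D + D * D) * X K < e / 2" "N \<le> K"
      by (auto simp: eventually_sequentially)
    have K0: "0 < K" using K(2) N by simp
    have [measurable]: "cube K z \<in> sets lebesgue" for z :: "'n \<Rightarrow> int"
      using cube_borel[OF K0, of z] by simp
    have [measurable]: "ball 0 (real m) \<in> sets (lebesgue :: (real ^ 'n) measure)" by simp
    define Z where "Z = cell K ` (ball 0 (real m) :: (real ^ 'n) set)"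
    have Z: "finite Z" unfolding Z_def by (rule finite_cell_image) simp
    \<comment> \<open>The modular of the difference of two step functions over the finitely many
      cubes that meet the ball. K is already fixed, so convergence of finitely many constants makes
      it small.\<close>
    define S where "S j k = (\<Sum>z\<in>Z. (1 / real K) ^ N * G \<bar>c (r j) K z - c (r k) K z\<bar>)" for j k
    have "((\<lambda>p. (\<Sum>z\<in>Z. (1 / real K) ^ N * G \<bar>c (r (fst p)) K z - c (r (snd p)) K z\<bar>)) \<longlongrightarrow>
        (\<Sum>z\<in>Z. (1 / real K) ^ N * G \<bar>L K z - L K z\<bar>)) (sequentially \<times>\<^sub>F sequentially)"
    proof (intro tendsto_sum tendsto_mult tendsto_const)
      fix z
      have "((\<lambda>p. c (r (fst p)) K z - c (r (snd p)) K z) \<longlongrightarrow> L K z - L K z) (sequentially \<times>\<^sub>F sequentially)"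
        by (intro tendsto_diff filterlim_compose[OF L[OF K(2)]] filterlim_fst filterlim_snd)
      then show "((\<lambda>p. G \<bar>c (r (fst p)) K z - c (r (snd p)) K z\<bar>) \<longlongrightarrow> G \<bar>L K z - L K z\<bar>) (sequentially \<times>\<^sub>F sequentially)"
        using continuous_on_tendsto_compose[OF continuous_on_G_abs] by fastforce
    qed
    then have "((\<lambda>p. S (fst p) (snd p)) \<longlongrightarrow> 0) (sequentially \<times>\<^sub>F sequentially)"
      by (simp add: zero S_def)
    then have "eventually (\<lambda>p. S (fst p) (snd p) < e / (2 * (D * D))) (sequentially \<times>\<^sub>F sequentially)"
      using e D(1) by (intro order_tendstoD(2)) auto
    then obtain M where M: "\<And>j k. M \<le> j \<Longrightarrow> M \<le> k \<Longrightarrow> S j k < e / (2 * (D * D))"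
      by (fastforce simp: eventually_prod_sequentially)
    have "(\<integral>\<^sup>+ x\<in>ball 0 (real m). eG (v (r j) x - v (r k) x) \<partial>lebesgue) \<le> ennreal e"
      if jk: "M \<le> j" "M \<le> k" for j k
    proof -
      let ?I = "indicator (ball 0 (real m)) :: real ^ 'n \<Rightarrow> ennreal"
      let ?a = "\<lambda>i x. eG (v (r i) x - c (r i) K (cell K x))"
      let ?s = "\<lambda>x. \<Sum>z\<in>Z. eG (c (r j) K z - c (r k) K z) * indicator (cube K z) x"
      \<comment> \<open>The constants depend on x through \<open>cell K x\<close>; rewriting as a
        finite sum over cubes inside the ball shows measurability.\<close>
      have [measurable]: "(\<lambda>x. ?a i x * ?I x) \<in> borel_measurable lebesgue" for i
      proof -
        have "(\<lambda>x. ?a i x * ?I x) = (\<lambda>x. \<Sum>z\<in>Z. eG (v (r i) x - c (r i) K z) * (indicator (cube K z) x * ?I x))"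
        proof
          fix x
          show "?a i x * ?I x = (\<Sum>z\<in>Z. eG (v (r i) x - c (r i) K z) * (indicator (cube K z) x * ?I x))"
          proof (cases "x \<in> ball 0 (real m)")
            case True
            then have "cell K x \<in> Z" by (simp add: Z_def)
            then have "{z \<in> Z. x \<in> cube K z} = {cell K x}" by (auto simp: cube_def)
            then show ?thesis using True Z by simp
          qed simp
        qed
        also have "\<dots> \<in> borel_measurable lebesgue" by measurable
        finally show ?thesis .
      qed
      have "(\<integral>\<^sup>+ x\<in>ball 0 (real m). eG (v (r j) x - v (r k) x) \<partial>lebesgue)
          \<le> (\<integral>\<^sup>+ x. ennreal D * (?a j x * ?I x) + (ennreal (D * D) * ?s x + ennreal (D * D) * (?a k x * ?I x)) \<partial>lebesgue)"
      proof (intro nn_integral_mono)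
        fix x
        show "eG (v (r j) x - v (r k) x) * ?I x
          \<le> ennreal D * (?a j x * ?I x) + (ennreal (D * D) * ?s x + ennreal (D * D) * (?a k x * ?I x))"
        proof (cases "x \<in> ball 0 (real m)")
          case True
          then have zZ: "cell K x \<in> Z" by (simp add: Z_def)
          let ?p = "v (r j) x - c (r j) K (cell K x)" and ?q = "c (r j) K (cell K x) - c (r k) K (cell K x)"
            and ?t = "c (r k) K (cell K x) - v (r k) x"
          have "eG (v (r j) x - v (r k) x) \<le> ennreal D * (eG ?p + eG (?q + ?t))"
            using D(2)[of ?p "?q + ?t"] by simp
          also have "\<dots> \<le> ennreal D * (eG ?p + ennreal D * (eG ?q + eG ?t))"
            by (intro mult_left_mono add_left_mono D(2)) auto
          also have "\<dots> = ennreal D * eG ?p + (ennreal (D * D) * eG ?q + ennreal (D * D) * eG ?t)"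
            using D(1) by (simp add: ennreal_mult distrib_left mult.assoc)
          also have "eG ?q \<le> ?s x"
            using member_le_sum[OF zZ _ Z, of "\<lambda>z. eG (c (r j) K z - c (r k) K z) * indicator (cube K z) x"]
            by (simp add: cube_def)
          finally show ?thesis
            using True by (simp add: abs_minus_commute add_left_mono add_right_mono mult_left_mono)
        qed simp
      qed
      also have "\<dots> = ennreal D * (\<integral>\<^sup>+ x\<in>ball 0 (real m). ?a j x \<partial>lebesgue)
          + (ennreal (D * D) * (\<integral>\<^sup>+ x. ?s x \<partial>lebesgue) + ennreal (D * D) * (\<integral>\<^sup>+ x\<in>ball 0 (real m). ?a k x \<partial>lebesgue))"
        by (simp add: nn_integral_add nn_integral_cmult)
      also have "(\<integral>\<^sup>+ x. ?s x \<partial>lebesgue) = ennreal (S j k)"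
      proof -
        have "(\<integral>\<^sup>+ x. ?s x \<partial>lebesgue)
            = (\<Sum>z\<in>Z. \<integral>\<^sup>+ x\<in>cube K z. eG (c (r j) K z - c (r k) K z) \<partial>lebesgue)"
          by (rule nn_integral_sum) measurable
        also have "\<dots> = (\<Sum>z\<in>Z. ennreal ((1 / real K) ^ N * G \<bar>c (r j) K z - c (r k) K z\<bar>))"
          by (intro sum.cong refl, subst nn_integral_cmult_indicator)
            (simp_all add: emeasure_cube[OF K0] N_def ennreal_mult nonneg mult.commute)
        also have "\<dots> = ennreal (S j k)"
          unfolding S_def by (rule sum_ennreal) (simp add: nonneg)
        finally show ?thesis .
      qed
      also have "ennreal D * (\<integral>\<^sup>+ x\<in>ball 0 (real m). ?a j x \<partial>lebesgue)
          + (ennreal (D * D) * ennreal (S j k) + ennreal (D * D) * (\<integral>\<^sup>+ x\<in>ball 0 (real m). ?a k x \<partial>lebesgue))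
          \<le> ennreal D * ennreal (X K) + (ennreal (D * D) * ennreal (e / (2 * (D * D))) + ennreal (D * D) * ennreal (X K))"
        using c[OF K(2), of "ball 0 (real m)"] M[OF jk]
        by (intro add_mono mult_left_mono ennreal_leI) auto
      also have "\<dots> = ennreal (D * X K + (e / 2 + D * D * X K))"
        using D(1) e X0[of K] by (simp add: ennreal_mult[symmetric] ennreal_plus[symmetric] del: ennreal_plus)
      also have "\<dots> \<le> ennreal e"
        using K(1) by (intro ennreal_leI) (simp add: algebra_simps)
      finally show ?thesis .
    qed
    then show ?thesis by blast
  qed
  show ?thesis
    by (rule exI[of _ r], rule conjI[OF r], intro allI impI, rule cau)
qed

section \<open>From modular to norm convergence\<close>

text \<open>By doubling, G(|w| / l) is at most C G(|w|) with C depending only on l. Once the modular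
  of the difference is at most 1/C, the number l is admissible in the infimum defining the
  norm.\<close>

lemma LG_loc_convergesI:
  fixes f :: "nat \<Rightarrow> real ^ 'n \<Rightarrow> real"
  assumes f[measurable]: "\<And>k. f k \<in> borel_measurable lebesgue" and v[measurable]: "v \<in> borel_measurable lebesgue"
    and lim: "\<And>m e. 0 < e \<Longrightarrow> \<exists>N. \<forall>k\<ge>N. (\<integral>\<^sup>+ x\<in>ball 0 (real m). eG (f k x - v x) \<partial>lebesgue) \<le> ennreal e"
    and fin: "\<And>k m. (\<integral>\<^sup>+ x\<in>ball 0 (real m). eG (f k x) \<partial>lebesgue) < \<infinity>"
  shows "LG_loc_converges G f v"
  unfolding LG_loc_converges_def
proof (intro allI impI)
  fix \<Omega> :: "(real ^ 'n) set"
  assume \<Omega>: "bounded \<Omega> \<and> \<Omega> \<in> sets lebesgue"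
  then obtain m where m: "\<Omega> \<subseteq> ball 0 (real m)"
    by (metis bounded_subset_ballD order_trans real_arch_simple subset_ball)
  have restrict: "(\<integral>\<^sup>+ x. F x \<partial>lebesgue_on \<Omega>) \<le> (\<integral>\<^sup>+ x\<in>ball 0 (real m). F x \<partial>lebesgue)" for F
    using \<Omega> m by (subst nn_integral_restrict_space) (auto intro!: nn_integral_mono simp: indicator_def)
  have [measurable]: "ball 0 (real m) \<in> sets (lebesgue :: (real ^ 'n) measure)" by simp
  have LGI: "w \<in> LG G \<Omega>" if [measurable]: "w \<in> borel_measurable lebesgue"
    and "(\<integral>\<^sup>+ x\<in>ball 0 (real m). eG (w x) \<partial>lebesgue) < \<infinity>" for w :: "real ^ 'n \<Rightarrow> real"
    unfolding LG_def using le_less_trans[OF restrict that(2)] measurable_restrict_space1[OF that(1)]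
    by (auto intro!: exI[of _ 1])
  obtain D where D: "D > 0" "\<And>x y. eG (x + y) \<le> ennreal D * (eG x + eG y)"
    using eG_add by blast
  obtain k where k: "(\<integral>\<^sup>+ x\<in>ball 0 (real m). eG (f k x - v x) \<partial>lebesgue) \<le> ennreal 1"
    using lim[of 1 m] by auto
  \<comment> \<open>The limit has finite modular because it is within modular distance 1 of a single
    \<open>f k\<close>.\<close>
  have "(\<integral>\<^sup>+ x\<in>ball 0 (real m). eG (v x) \<partial>lebesgue)
      \<le> (\<integral>\<^sup>+ x. ennreal D * (eG (f k x - v x) * indicator (ball 0 (real m)) x + eG (f k x) * indicator (ball 0 (real m)) x) \<partial>lebesgue)"
  proof (intro nn_integral_mono)
    fix x
    show "eG (v x) * indicator (ball 0 (real m)) x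
      \<le> ennreal D * (eG (f k x - v x) * indicator (ball 0 (real m)) x + eG (f k x) * indicator (ball 0 (real m)) x)"
      using D(2)[of "v x - f k x" "f k x"] by (auto simp: indicator_def abs_minus_commute)
  qed
  also have "\<dots> = ennreal D * ((\<integral>\<^sup>+ x\<in>ball 0 (real m). eG (f k x - v x) \<partial>lebesgue) + (\<integral>\<^sup>+ x\<in>ball 0 (real m). eG (f k x) \<partial>lebesgue))"
    by (subst nn_integral_cmult, measurable, subst nn_integral_add) auto
  also have "\<dots> < \<infinity>"
    using le_less_trans[OF k ennreal_less_top] fin[of k m] by (simp add: ennreal_mult_less_top)
  finally have v_LG: "v \<in> LG G \<Omega>"
    by (rule LGI[OF v])
  have "(\<lambda>k. LG_norm G \<Omega> (\<lambda>x. f k x - v x)) \<longlonglongrightarrow> 0"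
  proof (rule LIMSEQ_I)
    fix e :: real assume e: "0 < e"
    define l where "l = e / 2"
    have l: "0 < l" "l < e" using e by (auto simp: l_def)
    obtain C where C: "C > 0" "\<And>x. eG (1 / l * x) \<le> ennreal C * eG x"
      using eG_dilation[of "1 / l"] by blast
    obtain N where N: "\<And>k. N \<le> k \<Longrightarrow> (\<integral>\<^sup>+ x\<in>ball 0 (real m). eG (f k x - v x) \<partial>lebesgue) \<le> ennreal (1 / C)"
      using lim[of "1 / C" m] C(1) by auto
    have "norm (LG_norm G \<Omega> (\<lambda>x. f k x - v x) - 0) < e" if "N \<le> k" for k
    proof -
      define S where "S = {l. l > 0 \<and> (\<integral>\<^sup>+ x. ennreal (G (\<bar>f k x - v x\<bar> / l)) \<partial>lebesgue_on \<Omega>) \<le> 1}"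
      have "(\<integral>\<^sup>+ x. ennreal (G (\<bar>f k x - v x\<bar> / l)) \<partial>lebesgue_on \<Omega>)
          \<le> (\<integral>\<^sup>+ x\<in>ball 0 (real m). ennreal (G (\<bar>f k x - v x\<bar> / l)) \<partial>lebesgue)"
        by (rule restrict)
      also have "\<dots> \<le> (\<integral>\<^sup>+ x. ennreal C * (eG (f k x - v x) * indicator (ball 0 (real m)) x) \<partial>lebesgue)"
      proof (intro nn_integral_mono)
        fix x
        show "ennreal (G (\<bar>f k x - v x\<bar> / l)) * indicator (ball 0 (real m)) x
            \<le> ennreal C * (eG (f k x - v x) * indicator (ball 0 (real m)) x)"
          using C(2)[of "f k x - v x"] l(1) by (auto simp: indicator_def abs_mult)
      qed
      also have "\<dots> = ennreal C * (\<integral>\<^sup>+ x\<in>ball 0 (real m). eG (f k x - v x) \<partial>lebesgue)"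
        by (rule nn_integral_cmult) measurable
      also have "\<dots> \<le> ennreal C * ennreal (1 / C)"
        by (intro mult_left_mono N that) simp
      also have "\<dots> = 1" using C(1) by (simp add: ennreal_mult[symmetric])
      finally have "l \<in> S" using l(1) by (simp add: S_def)
      moreover have "bdd_below S" by (rule bdd_belowI[of _ 0]) (auto simp: S_def)
      ultimately have "Inf S \<le> l" by (rule cInf_lower)
      moreover have "0 \<le> Inf S"
        using \<open>l \<in> S\<close> by (intro cInf_greatest) (auto simp: S_def)
      ultimately show ?thesis
        using l by (simp add: LG_norm_def S_def)
    qed
    then show "\<exists>N. \<forall>k\<ge>N. norm (LG_norm G \<Omega> (\<lambda>x. f k x - v x) - 0) < e" by blast
  qed
  then show "LG_converges G \<Omega> f v"
    unfolding LG_converges_def using LGI[OF f fin] v_LG by blast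
qed

section \<open>The local bound that replaces a bound in L^G\<close>

text \<open>The sublevel set has measure at least a, so it contains a good reference point y for the
  large ball, and |v y| <= t removes the freedom of adding a constant. B precedes v in the
  quantifiers, which makes the bound uniform along a sequence.\<close>

lemma local_bound:
  assumes s: "0 < s" and P: "0 \<le> P" and R: "0 < R" and a: "0 < a" and t: "0 \<le> t"
  shows "\<exists>B. \<forall>v :: real ^ 'n \<Rightarrow> real. v \<in> borel_measurable lebesgue \<longrightarrow> Phi s G v \<le> ennreal P \<longrightarrow>
    ennreal a \<le> emeasure lebesgue {x \<in> ball 0 R. \<bar>v x\<bar> \<le> t} \<longrightarrow>
    (\<integral>\<^sup>+ x\<in>ball 0 (real m). eG (v x) \<partial>lebesgue) \<le> ennreal B"
proof -
  \<comment> \<open>Bounds the distance between a point of the large ball and a point of the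
    sublevel set inside \<open>ball 0 R\<close>.\<close>
  define d where "d = real m + R"
  have d: "0 < d" using R by (simp add: d_def)
  obtain C where C: "C > 0" "\<And>t. 0 \<le> t \<Longrightarrow> G (d powr s * t) \<le> C * G t"
    using G_dilation[of "d powr s"] by auto
  obtain D where D: "D > 0" "\<And>x y. eG (x + y) \<le> ennreal D * (eG x + eG y)"
    using eG_add by blast
  have [measurable]: "ball 0 r \<in> sets (lebesgue :: (real ^ 'n) measure)" for r by simp
  define b where "b = measure lebesgue (ball (0 :: real ^ 'n) (real m))"
  have b: "emeasure lebesgue (ball (0 :: real ^ 'n) (real m)) = ennreal b" "0 \<le> b"
    using emeasure_bounded_finite[of "ball (0 :: real ^ 'n) (real m)"]
    unfolding b_def by (auto intro!: emeasure_eq_ennreal_measure)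
  define Y where "Y = d ^ CARD('n) * C * P"
  have Y: "0 \<le> Y" using d C P by (simp add: Y_def)
  have "(\<integral>\<^sup>+ x\<in>ball 0 (real m). eG (v x) \<partial>lebesgue) \<le> ennreal (D * (Y / a + G t * b))"
    if v[measurable]: "v \<in> borel_measurable lebesgue" and Phi: "Phi s G v \<le> ennreal P"
      and A: "ennreal a \<le> emeasure lebesgue {x \<in> ball 0 R. \<bar>v x\<bar> \<le> t}" for v :: "real ^ 'n \<Rightarrow> real"
  proof -
    define A where "A = {x \<in> ball 0 R. \<bar>v x\<bar> \<le> t}"
    let ?Q = "ball (0 :: real ^ 'n) (real m)"
    have "A = ball 0 R \<inter> {x \<in> space lebesgue. \<bar>v x\<bar> \<le> t}" by (auto simp: A_def)
    also have "\<dots> \<in> sets lebesgue" by measurable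
    finally have Am: "A \<in> sets lebesgue" .
    have A0: "emeasure lebesgue A \<noteq> 0" using A a unfolding A_def[symmetric] by (auto simp: ennreal_eq_0_iff)
    have "emeasure lebesgue A \<le> emeasure lebesgue (ball (0 :: real ^ 'n) R)"
      by (rule emeasure_mono) (auto simp: A_def)
    then have Afin: "emeasure lebesgue A \<noteq> \<infinity>"
      using emeasure_bounded_finite[of "ball (0 :: real ^ 'n) R"] by (auto simp: top_unique)
    have Qm: "?Q \<in> sets lebesgue" by simp
    have dist: "norm (x - y) \<le> d" if "x \<in> ?Q" "y \<in> A" for x y
      using that norm_triangle_ineq4[of x y] by (auto simp: A_def d_def)
    obtain y where y: "y \<in> A" and le: "emeasure lebesgue A * (\<integral>\<^sup>+ x\<in>?Q. eG (v x - v y) \<partial>lebesgue)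
      \<le> ennreal (d ^ CARD('n) * C) *
        (\<integral>\<^sup>+ x. \<integral>\<^sup>+ y. gagliardo s G v x y * indicator A x * indicator ?Q y \<partial>lebesgue \<partial>lebesgue)"
      using exists_good_value[OF v s d less_imp_le[OF C(1)] C(2) Am Qm A0 Afin dist] by blast
    have "ennreal a * (\<integral>\<^sup>+ x\<in>?Q. eG (v x - v y) \<partial>lebesgue) \<le> emeasure lebesgue A * (\<integral>\<^sup>+ x\<in>?Q. eG (v x - v y) \<partial>lebesgue)"
      using A unfolding A_def by (rule mult_right_mono) simp
    also note le
    also have "ennreal (d ^ CARD('n) * C) *
        (\<integral>\<^sup>+ x. \<integral>\<^sup>+ y. gagliardo s G v x y * indicator A x * indicator ?Q y \<partial>lebesgue \<partial>lebesgue)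
        \<le> ennreal (d ^ CARD('n) * C) * (\<integral>\<^sup>+ x. \<integral>\<^sup>+ y. gagliardo s G v x y \<partial>lebesgue \<partial>lebesgue)"
      by (intro mult_left_mono nn_integral_mono) (auto simp: indicator_def)
    also have "\<dots> \<le> ennreal (d ^ CARD('n) * C) * ennreal P"
      using Phi by (intro mult_left_mono) (auto simp: Phi_eq_iterated[OF v])
    also have "\<dots> = ennreal Y"
      using P d C(1) by (simp add: Y_def ennreal_mult[symmetric])
    finally have "ennreal (1 / a) * (ennreal a * (\<integral>\<^sup>+ x\<in>?Q. eG (v x - v y) \<partial>lebesgue)) \<le> ennreal (1 / a) * ennreal Y"
      by (rule mult_left_mono) simp
    then have I: "(\<integral>\<^sup>+ x\<in>?Q. eG (v x - v y) \<partial>lebesgue) \<le> ennreal (Y / a)"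
      using a Y by (simp add: mult.assoc[symmetric] ennreal_mult[symmetric])
    have Gy: "eG (v y) \<le> ennreal (G t)"
      using y by (auto simp: A_def intro!: ennreal_leI mono)
    have "(\<integral>\<^sup>+ x\<in>?Q. eG (v x) \<partial>lebesgue) \<le> (\<integral>\<^sup>+ x. ennreal D * (eG (v x - v y) * indicator ?Q x + ennreal (G t) * indicator ?Q x) \<partial>lebesgue)"
    proof (intro nn_integral_mono)
      fix x
      have "eG (v x) \<le> ennreal D * (eG (v x - v y) + eG (v y))"
        using D(2)[of "v x - v y" "v y"] by simp
      also have "\<dots> \<le> ennreal D * (eG (v x - v y) + ennreal (G t))"
        using Gy by (intro mult_left_mono add_left_mono) auto
      finally show "eG (v x) * indicator ?Q x \<le> ennreal D * (eG (v x - v y) * indicator ?Q x + ennreal (G t) * indicator ?Q x)"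
        by (auto simp: indicator_def)
    qed
    also have "\<dots> = ennreal D * ((\<integral>\<^sup>+ x\<in>?Q. eG (v x - v y) \<partial>lebesgue) + ennreal (G t) * emeasure lebesgue ?Q)"
      by (subst nn_integral_cmult, measurable, subst nn_integral_add) (auto simp: nn_integral_cmult_indicator)
    also have "\<dots> \<le> ennreal D * (ennreal (Y / a) + ennreal (G t) * ennreal b)"
      unfolding b by (intro mult_left_mono add_right_mono I) simp
    also have "\<dots> = ennreal (D * (Y / a + G t * b))"
      using D(1) Y a b(2) nonneg[OF t] by (simp add: ennreal_mult[symmetric] ennreal_plus[symmetric] del: ennreal_plus)
    finally show ?thesis .
  qed
  then show ?thesis by blast
qed

end

section \<open>Half-filled balls and their neighbours\<close>

lemma sets_lebesgue_abs_superlevel: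
  fixes u :: "'a::euclidean_space \<Rightarrow> real"
  assumes [measurable]: "u \<in> borel_measurable lebesgue"
  shows "{x. \<bar>u x\<bar> > t} \<in> sets lebesgue"
proof -
  have "{x \<in> space lebesgue. t < \<bar>u x\<bar>} \<in> sets lebesgue" by measurable
  then show ?thesis by simp
qed

lemma emeasure_ball_diff_ge:
  fixes E :: "(real ^ 'n) set"
  defines "b r \<equiv> unit_ball_vol (real CARD('n)) * r ^ CARD('n) / 2"
  assumes E[measurable]: "E \<in> sets lebesgue" and h: "0 < h"
    and small: "emeasure lebesgue (E \<inter> ball x h) < ennreal (b h)"
  shows "ennreal (b h) \<le> emeasure lebesgue (ball x h - E)"
proof -
  have "ennreal (b h + b h) = emeasure lebesgue (ball x h)"
    using h by (simp add: emeasure_ball b_def)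
  also have "\<dots> \<le> emeasure lebesgue (E \<inter> ball x h) + emeasure lebesgue (ball x h - E)"
    by (rule order_trans[OF emeasure_mono emeasure_subadditive]) (use E in \<open>auto intro!: sets.Un sets.Int sets.Diff\<close>)
  finally show ?thesis
    using add_mono_ennreal[OF small, of "emeasure lebesgue (ball x h - E)" "b h"] by (meson not_le)
qed

context delta2_young
begin

text \<open>Chebyshev's inequality for the modular. It is the point where membership of u in L^G
  enters: finite measure stops the walk along a line.\<close>

lemma superlevel_emeasure_finite:
  fixes u :: "real ^ 'n \<Rightarrow> real"
  assumes u[measurable]: "u \<in> borel_measurable lebesgue" and t: "0 < t" and l: "0 < l"
    and fin: "(\<integral>\<^sup>+ x. ennreal (G (l * \<bar>u x\<bar>)) \<partial>lebesgue) < \<infinity>"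
  shows "emeasure lebesgue {x. \<bar>u x\<bar> > t} < \<infinity>"
proof -
  have m[measurable]: "{x. \<bar>u x\<bar> > t} \<in> sets lebesgue"
    using u by (rule sets_lebesgue_abs_superlevel)
  have "ennreal (G (l * t)) * emeasure lebesgue {x. \<bar>u x\<bar> > t} = (\<integral>\<^sup>+ x\<in>{x. \<bar>u x\<bar> > t}. ennreal (G (l * t)) \<partial>lebesgue)"
    by (rule nn_integral_cmult_indicator[symmetric]) measurable
  also have "\<dots> \<le> (\<integral>\<^sup>+ x. ennreal (G (l * \<bar>u x\<bar>)) \<partial>lebesgue)"
    using l t by (intro nn_integral_mono) (auto simp: indicator_def intro!: ennreal_leI mono)
  finally have "ennreal (G (l * t)) * emeasure lebesgue {x. \<bar>u x\<bar> > t} < \<infinity>"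
    using fin by (rule le_less_trans)
  moreover have "0 < G (l * t)" using l t by (intro pos) simp
  ultimately show ?thesis
    by (auto simp: ennreal_mult_less_top ennreal_eq_0_iff)
qed

text \<open>Otherwise each x with |u x| > \<tau> sees at least half of \<open>ball x h\<close> at
  values at most \<tau>/2. The volume h^N of that half cancels the weight h^(-N), and integration
  over x contributes the factor \<delta>. \<open>large\<close> is the failure of the resulting
  inequality.\<close>

lemma exists_dense_ball:
  fixes u :: "real ^ 'n \<Rightarrow> real"
  assumes u[measurable]: "u \<in> borel_measurable lebesgue" and s: "0 < s"
    and \<tau>: "0 < \<tau>" and \<delta>: "0 < \<delta>" and P: "0 \<le> P" and Phi: "Phi s G u \<le> ennreal P"
    and F: "ennreal \<delta> \<le> emeasure lebesgue {x. \<bar>u x\<bar> > \<tau>}"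
    and h: "0 < h" "h \<le> 1"
    and large: "2 * P * h powr s < \<delta> * unit_ball_vol (real CARD('n)) * G (\<tau> / 2)"
  shows "\<exists>x. ennreal (unit_ball_vol (real CARD('n)) * h ^ CARD('n) / 2)
    \<le> emeasure lebesgue ({x. \<bar>u x\<bar> > \<tau> / 2} \<inter> ball x h)"
proof (rule ccontr)
  define \<beta> where "\<beta> = unit_ball_vol (real CARD('n)) * h ^ CARD('n)"
  define E where "E = {x. \<bar>u x\<bar> > \<tau> / 2}"
  \<comment> \<open>A lower bound for the kernel at distance at most h across the gap
    \<tau>/2.\<close>
  define q where "q = 1 / h ^ CARD('n) * G (\<tau> / 2 / h powr s)"
  assume "\<not> ?thesis"
  then have small: "emeasure lebesgue (E \<inter> ball x h) < ennreal (\<beta> / 2)" for x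
    by (auto simp: not_le E_def \<beta>_def)
  have \<beta>: "0 < \<beta>" using h by (simp add: \<beta>_def)
  have em[measurable]: "E \<in> sets lebesgue" "{x. \<bar>u x\<bar> > \<tau>} \<in> sets lebesgue"
    unfolding E_def by (rule sets_lebesgue_abs_superlevel[OF u])+
  have [measurable]: "ball x h \<in> sets (lebesgue :: (real ^ 'n) measure)" for x by simp
  have q: "0 \<le> q" using h \<tau> nonneg[of "\<tau> / 2 / h powr s"] by (simp add: q_def)
  have big: "ennreal (\<beta> / 2) \<le> emeasure lebesgue (ball x h - E)" for x
    using emeasure_ball_diff_ge[OF em(1) h(1), of x] small[of x] by (simp add: \<beta>_def)
  have lower: "ennreal (\<beta> / 2 * q) \<le> (\<integral>\<^sup>+ y. gagliardo s G u x y \<partial>lebesgue)" if x: "\<bar>u x\<bar> > \<tau>" for x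
  proof -
    have "ennreal (\<beta> / 2 * q) = ennreal q * ennreal (\<beta> / 2)"
      using \<beta> q by (simp add: ennreal_mult[symmetric] mult.commute)
    also have "\<dots> \<le> ennreal q * emeasure lebesgue (ball x h - E)"
      by (intro mult_left_mono big) simp
    also have "\<dots> = (\<integral>\<^sup>+ y\<in>ball x h - E. ennreal q \<partial>lebesgue)"
      by (rule nn_integral_cmult_indicator[symmetric]) measurable
    also have "\<dots> \<le> (\<integral>\<^sup>+ y. gagliardo s G u x y \<partial>lebesgue)"
    proof (intro nn_integral_mono)
      fix y
      show "ennreal q * indicator (ball x h - E) y \<le> gagliardo s G u x y"
      proof (cases "y \<in> ball x h - E")
        case True
        then have y: "norm (x - y) < h" "\<bar>u y\<bar> \<le> \<tau> / 2" by (auto simp: E_def dist_norm)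
        then have "x \<noteq> y" using x \<tau> by auto
        define r where "r = norm (x - y)"
        have r: "0 < r" "r \<le> h" using y \<open>x \<noteq> y\<close> by (auto simp: r_def)
        have "\<tau> / 2 \<le> \<bar>u x - u y\<bar>" using x y by linarith
        then have "\<tau> / 2 / h powr s \<le> \<bar>u x - u y\<bar> / r powr s"
          using r s \<tau> by (intro frac_le powr_mono2) auto
        then have "G (\<tau> / 2 / h powr s) \<le> G \<bar>D_quot s u x y\<bar>"
          using \<tau> by (intro mono) (auto simp: D_quot_def r_def[symmetric])
        moreover have "1 / h ^ CARD('n) \<le> 1 / r ^ CARD('n)"
          using r by (intro divide_left_mono power_mono) auto
        ultimately have "q \<le> 1 / r ^ CARD('n) * G \<bar>D_quot s u x y\<bar>"
          unfolding q_def using r \<tau> nonneg[of "\<tau> / 2 / h powr s"] by (intro mult_mono) auto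
        then have "ennreal q \<le> ennreal (1 / r ^ CARD('n) * G \<bar>D_quot s u x y\<bar>)"
          by (rule ennreal_leI)
        also have "\<dots> = gagliardo s G u x y"
          using r by (subst ennreal_mult) (auto simp: gagliardo_def r_def[symmetric] nonneg)
        finally show ?thesis using True by simp
      qed simp
    qed
    finally show ?thesis .
  qed
  have "ennreal (\<beta> / 2 * q * \<delta>) = ennreal (\<beta> / 2 * q) * ennreal \<delta>"
    using \<beta> q \<delta> by (intro ennreal_mult) auto
  also have "\<dots> \<le> ennreal (\<beta> / 2 * q) * emeasure lebesgue {x. \<bar>u x\<bar> > \<tau>}"
    by (intro mult_left_mono F) simp
  also have "\<dots> = (\<integral>\<^sup>+ x\<in>{x. \<bar>u x\<bar> > \<tau>}. ennreal (\<beta> / 2 * q) \<partial>lebesgue)"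
    by (rule nn_integral_cmult_indicator[symmetric]) measurable
  also have "\<dots> \<le> (\<integral>\<^sup>+ x. \<integral>\<^sup>+ y. gagliardo s G u x y \<partial>lebesgue \<partial>lebesgue)"
    using lower by (intro nn_integral_mono) (auto simp: indicator_def)
  also have "\<dots> \<le> ennreal P"
    using Phi by (simp add: Phi_eq_iterated)
  finally have le: "\<beta> / 2 * q * \<delta> \<le> P"
    using P by (simp add: ennreal_le_iff)
  \<comment> \<open>Convexity yields the factor h^(-s) by which the energy would exceed P.\<close>
  have "G (\<tau> / 2) \<le> h powr s * G (\<tau> / 2 / h powr s)"
    using scale[of "h powr s" "\<tau> / 2 / h powr s"] h s \<tau> by (simp add: powr_le1)
  then have "\<delta> * unit_ball_vol (real CARD('n)) * G (\<tau> / 2) \<le> \<delta> * unit_ball_vol (real CARD('n)) * (h powr s * G (\<tau> / 2 / h powr s))"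
    using \<delta> by (intro mult_left_mono) auto
  also have "\<dots> = 2 * h powr s * (\<beta> / 2 * q * \<delta>)"
    using h by (simp add: \<beta>_def q_def)
  also have "\<dots> \<le> 2 * h powr s * P"
    using le by (intro mult_left_mono) auto
  also have "\<dots> = 2 * P * h powr s" by simp
  finally show False
    using large by simp
qed

text \<open>Centres spaced by 2h have disjoint balls, so infinitely many of them each holding
  measure c would make E infinite. By induction a success is followed immediately by a failure
  somewhere.\<close>

lemma exists_transition_balls:
  fixes E :: "(real ^ 'n) set"
  assumes E[measurable]: "E \<in> sets lebesgue" and fin: "emeasure lebesgue E < \<infinity>"
    and h: "0 < h" and c: "0 < c"
    and x: "ennreal c \<le> emeasure lebesgue (E \<inter> ball x h)"
  shows "\<exists>x x'. norm (x' - x) \<le> 2 * h \<and> ennreal c \<le> emeasure lebesgue (E \<inter> ball x h)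
    \<and> emeasure lebesgue (E \<inter> ball x' h) < ennreal c"
proof -
  \<comment> \<open>Any coordinate direction serves; \<open>undefined\<close> picks one.\<close>
  define e :: "real ^ 'n" where "e = axis undefined 1"
  have e: "norm e = 1" by (simp add: e_def)
  define X where "X j = x + (2 * h * real j) *\<^sub>R e" for j :: nat
  define Q where "Q j \<longleftrightarrow> ennreal c \<le> emeasure lebesgue (E \<inter> ball (X j) h)" for j
  have "\<exists>j. \<not> Q j"
  proof (rule ccontr)
    assume "\<not> ?thesis"
    then have all: "ennreal c \<le> emeasure lebesgue (E \<inter> ball (X j) h)" for j by (auto simp: Q_def)
    have disj: "ball (X i) h \<inter> ball (X j) h = {}" if "i \<noteq> j" for i j
    proof (rule disjoint_ballI)
      have "1 \<le> \<bar>real i - real j\<bar>" using that by linarith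
      then have "2 * h * 1 \<le> 2 * h * \<bar>real i - real j\<bar>" using h by (intro mult_left_mono) auto
      also have "\<dots> = dist (X i) (X j)"
        using h by (simp add: X_def dist_norm e abs_mult flip: scaleR_left_diff_distrib right_diff_distrib)
      finally show "h + h \<le> dist (X i) (X j)" by simp
    qed
    have bound: "ennreal (real n * c) \<le> emeasure lebesgue E" for n
    proof -
      have "ennreal (real n * c) = (\<Sum>j<n. ennreal c)"
        using c by (simp add: ennreal_mult ennreal_of_nat_eq_real_of_nat)
      also have "\<dots> \<le> (\<Sum>j<n. emeasure lebesgue (E \<inter> ball (X j) h))"
        by (intro sum_mono all)
      also have "\<dots> = emeasure lebesgue (\<Union>j<n. E \<inter> ball (X j) h)"
        using disj by (intro sum_emeasure) (auto simp: disjoint_family_on_def)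
      also have "\<dots> \<le> emeasure lebesgue E"
        by (intro emeasure_mono) auto
      finally show ?thesis .
    qed
    obtain M where M: "emeasure lebesgue E = ennreal M" "0 \<le> M"
      using fin by (cases "emeasure lebesgue E") auto
    obtain n where "M < real n * c"
      using reals_Archimedean3[OF c] by blast
    then show False
      using bound[of n] M by (simp add: ennreal_le_iff)
  qed
  moreover have "Q 0" using x by (simp add: Q_def X_def)
  ultimately obtain j where j: "Q j" "\<not> Q (Suc j)"
    by (metis nat_induct)
  have "X (Suc j) - X j = (2 * h) *\<^sub>R e"
    by (simp add: X_def algebra_simps)
  then have "norm (X (Suc j) - X j) \<le> 2 * h" using h e by simp
  then show ?thesis
    using j unfolding Q_def not_le by blast
qed

end

section \<open>Integer translations\<close>

lemma emeasure_lebesgue_translation: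
  fixes S :: "'a::euclidean_space set"
  assumes S: "S \<in> sets lebesgue"
  shows "{x. x + a \<in> S} \<in> sets lebesgue" "emeasure lebesgue {x. x + a \<in> S} = emeasure lebesgue S"
proof -
  show *: "{x. x + a \<in> S} \<in> sets lebesgue"
    using measurable_sets[OF measurable_lebesgue_translation[of a] S] by (simp add: vimage_def)
  have "emeasure lebesgue {x. x + a \<in> S} = (\<integral>\<^sup>+ x. indicator S (x + a) \<partial>lebesgue)"
    by (subst nn_integral_indicator[OF *, symmetric]) (auto intro!: nn_integral_cong simp: indicator_def)
  also have "\<dots> = emeasure lebesgue S"
    using S by (subst nn_integral_lebesgue_translation) auto
  finally show "emeasure lebesgue {x. x + a \<in> S} = emeasure lebesgue S" .
qed

lemma norm_diff_floor_le:
  fixes x :: "real ^ 'n"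
  shows "norm (x - (\<chi> i. of_int \<lfloor>x $ i\<rfloor>)) \<le> real CARD('n)"
proof -
  have "norm (x - (\<chi> i. of_int \<lfloor>x $ i\<rfloor>)) \<le> (\<Sum>i\<in>UNIV. \<bar>(x - (\<chi> i. of_int \<lfloor>x $ i\<rfloor>)) $ i\<bar>)"
    by (rule norm_le_l1_cart)
  also have "\<dots> \<le> (\<Sum>i\<in>(UNIV::'n set). 1)"
  proof (rule sum_mono)
    fix i
    show "\<bar>(x - (\<chi> i. of_int \<lfloor>x $ i\<rfloor>)) $ i\<bar> \<le> 1"
      using floor_correct[of "x $ i"] by (simp add: abs_le_iff) linarith
  qed
  finally show ?thesis by simp
qed

context delta2_young
begin

text \<open>R and a are fixed before u: the radius h depends only on s, \<tau>, \<delta>, P, the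
  dimension and G, and a is half the volume of a ball of radius h.\<close>

lemma exists_integer_translation:
  fixes s \<tau> \<delta> P :: real
  assumes s: "0 < s" and \<tau>: "0 < \<tau>" and \<delta>: "0 < \<delta>" and P: "0 \<le> P"
  shows "\<exists>R>0. \<exists>a>0. \<forall>u :: real ^ 'n \<Rightarrow> real. u \<in> LG G UNIV \<longrightarrow> Phi s G u \<le> ennreal P \<longrightarrow>
    ennreal \<delta> \<le> emeasure lebesgue {x. \<bar>u x\<bar> > \<tau>} \<longrightarrow>
    (\<exists>y. (\<forall>i. y $ i \<in> \<int>)
      \<and> ennreal a \<le> emeasure lebesgue {x \<in> ball 0 R. \<bar>u (x + y)\<bar> > \<tau> / 2}
      \<and> ennreal a \<le> emeasure lebesgue {x \<in> ball 0 R. \<bar>u (x + y)\<bar> \<le> \<tau> / 2})"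
proof -
  define V where "V = unit_ball_vol (real CARD('n))"
  \<comment> \<open>The radius is chosen so that h^s <= q, which gives the smallness condition of
    \<open>exists_dense_ball\<close>. P + 1 instead of P makes that inequality strict and allows P =
    0.\<close>
  define q where "q = \<delta> * V * G (\<tau> / 2) / (2 * (P + 1))"
  define h where "h = min 1 (q powr (1 / s))"
  have Gt: "0 < G (\<tau> / 2)" using \<tau> by (intro pos) simp
  have V: "0 < V" by (simp add: V_def)
  have q: "0 < q" using \<delta> V Gt P by (simp add: q_def)
  have h: "0 < h" "h \<le> 1" using q by (auto simp: h_def)
  have "h powr s \<le> (q powr (1 / s)) powr s"
    using h s by (intro powr_mono2) (auto simp: h_def)
  also have "\<dots> = q" using s q by (simp add: powr_powr)
  finally have "2 * P * h powr s \<le> 2 * P * q"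
    using P by (intro mult_left_mono) auto
  also have "\<dots> < 2 * (P + 1) * q" using q by simp
  also have "\<dots> = \<delta> * V * G (\<tau> / 2)" using P by (simp add: q_def)
  finally have large: "2 * P * h powr s < \<delta> * unit_ball_vol (real CARD('n)) * G (\<tau> / 2)"
    by (simp add: V_def)
  define a where "a = V * h ^ CARD('n) / 2"
  \<comment> \<open>Rounding the centre to an integer point moves it by at most the dimension; the
    neighbouring centre adds at most 2h <= 2, and the radius h at most 1.\<close>
  define R where "R = real CARD('n) + 3"
  have a: "0 < a" using V h by (simp add: a_def)
  have "\<exists>y. (\<forall>i. y $ i \<in> \<int>)
      \<and> ennreal a \<le> emeasure lebesgue {x \<in> ball 0 R. \<bar>u (x + y)\<bar> > \<tau> / 2}
      \<and> ennreal a \<le> emeasure lebesgue {x \<in> ball 0 R. \<bar>u (x + y)\<bar> \<le> \<tau> / 2}"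
    if u: "u \<in> LG G UNIV" and Phi: "Phi s G u \<le> ennreal P"
      and super: "ennreal \<delta> \<le> emeasure lebesgue {x. \<bar>u x\<bar> > \<tau>}" for u :: "real ^ 'n \<Rightarrow> real"
  proof -
    define E where "E = {x. \<bar>u x\<bar> > \<tau> / 2}"
    have um[measurable]: "u \<in> borel_measurable lebesgue"
      using u by (simp add: LG_def lebesgue_on_UNIV_eq)
    obtain l where l: "0 < l" "(\<integral>\<^sup>+ x. ennreal (G (l * \<bar>u x\<bar>)) \<partial>lebesgue) < \<infinity>"
      using u by (auto simp: LG_def lebesgue_on_UNIV_eq)
    have E: "E \<in> sets lebesgue" unfolding E_def by (rule sets_lebesgue_abs_superlevel[OF um])
    have Efin: "emeasure lebesgue E < \<infinity>"
      unfolding E_def by (rule superlevel_emeasure_finite[OF um _ l]) (use \<tau> in simp)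
    obtain x0 where "ennreal a \<le> emeasure lebesgue (E \<inter> ball x0 h)"
      using exists_dense_ball[OF um s \<tau> \<delta> P Phi super h large] unfolding a_def V_def E_def by blast
    then obtain x x' where x: "norm (x' - x) \<le> 2 * h" "ennreal a \<le> emeasure lebesgue (E \<inter> ball x h)"
      and x': "emeasure lebesgue (E \<inter> ball x' h) < ennreal a"
      using exists_transition_balls[OF E Efin h(1) a] by blast
    have x'': "ennreal a \<le> emeasure lebesgue (ball x' h - E)"
      using emeasure_ball_diff_ge[OF E h(1), of x'] x' by (simp add: a_def V_def)
    define y :: "real ^ 'n" where "y = (\<chi> i. of_int \<lfloor>x $ i\<rfloor>)"
    have xy: "norm (x - y) \<le> real CARD('n)"
      unfolding y_def by (rule norm_diff_floor_le)
    have near: "z \<in> ball 0 R" if "z + y \<in> ball p h" "norm (p - x) \<le> 2" for z p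
    proof -
      have eq: "(z + y - p) + (p - x) + (x - y) = z" by simp
      have "norm z \<le> norm ((z + y - p) + (p - x)) + norm (x - y)"
        using norm_triangle_ineq[of "(z + y - p) + (p - x)" "x - y"] unfolding eq .
      also have "\<dots> \<le> norm (z + y - p) + norm (p - x) + norm (x - y)"
        by (intro add_right_mono norm_triangle_ineq)
      finally have "norm z \<le> norm (p - (z + y)) + norm (p - x) + norm (x - y)"
        by (simp add: norm_minus_commute)
      then show ?thesis using that xy h by (simp add: R_def dist_norm)
    qed
    have uy: "(\<lambda>z. u (z + y)) \<in> borel_measurable lebesgue" by measurable
    have "{z. \<bar>u (z + y)\<bar> > \<tau> / 2} \<in> sets lebesgue"
      by (rule sets_lebesgue_abs_superlevel[OF uy])
    moreover have "{z \<in> ball 0 R. \<bar>u (z + y)\<bar> > \<tau> / 2} = ball 0 R \<inter> {z. \<bar>u (z + y)\<bar> > \<tau> / 2}"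
      "{z \<in> ball 0 R. \<bar>u (z + y)\<bar> \<le> \<tau> / 2} = ball 0 R - {z. \<bar>u (z + y)\<bar> > \<tau> / 2}"
      by auto
    moreover have "ball 0 R \<in> sets (lebesgue :: (real ^ 'n) measure)" by simp
    ultimately have meas: "{z \<in> ball 0 R. \<bar>u (z + y)\<bar> > \<tau> / 2} \<in> sets lebesgue"
        "{z \<in> ball 0 R. \<bar>u (z + y)\<bar> \<le> \<tau> / 2} \<in> sets lebesgue"
      by (simp_all only: sets.Int sets.Diff)
    have balls: "E \<inter> ball x h \<in> sets lebesgue" "ball x' h - E \<in> sets lebesgue"
      using E by auto
    have "emeasure lebesgue (E \<inter> ball x h) = emeasure lebesgue {z. z + y \<in> E \<inter> ball x h}"
      by (rule emeasure_lebesgue_translation(2)[OF balls(1), symmetric])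
    also have "\<dots> \<le> emeasure lebesgue {z \<in> ball 0 R. \<bar>u (z + y)\<bar> > \<tau> / 2}"
      using near[of _ x] by (intro emeasure_mono meas) (auto simp: E_def)
    finally have 1: "ennreal a \<le> emeasure lebesgue {z \<in> ball 0 R. \<bar>u (z + y)\<bar> > \<tau> / 2}"
      using x(2) by (rule order_trans[rotated])
    have "emeasure lebesgue (ball x' h - E) = emeasure lebesgue {z. z + y \<in> ball x' h - E}"
      by (rule emeasure_lebesgue_translation(2)[OF balls(2), symmetric])
    also have "\<dots> \<le> emeasure lebesgue {z \<in> ball 0 R. \<bar>u (z + y)\<bar> \<le> \<tau> / 2}"
      using near[of _ x'] x(1) h by (intro emeasure_mono meas) (auto simp: E_def)
    finally have 2: "ennreal a \<le> emeasure lebesgue {z \<in> ball 0 R. \<bar>u (z + y)\<bar> \<le> \<tau> / 2}"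
      using x'' by (rule order_trans[rotated])
    show ?thesis
      using 1 2 by (intro exI[of _ y]) (auto simp: y_def)
  qed
  moreover have "0 < R" by (simp add: R_def)
  ultimately show ?thesis using a by blast
qed

section \<open>Convergence of the translates to a nontrivial limit\<close>

lemma translation_compactness:
  fixes u :: "nat \<Rightarrow> real ^ 'n \<Rightarrow> real"
  assumes s: "0 < s" and P: "0 \<le> P" and Phi: "\<And>n. Phi s G (u n) \<le> ennreal P"
    and u: "\<And>n. u n \<in> LG G UNIV"
    and \<tau>: "0 < \<tau>" and \<delta>: "0 < \<delta>"
    and super: "\<And>n. ennreal \<delta> \<le> emeasure lebesgue {x. \<bar>u n x\<bar> > \<tau>}"
  shows "\<exists>y :: nat \<Rightarrow> real ^ 'n. (\<forall>n i. y n $ i \<in> \<int>) \<and>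
    (\<exists>r v. strict_mono r \<and> LG_loc_converges G (\<lambda>k x. u (r k) (x + y (r k))) v \<and>
       \<not> (AE x in lebesgue. v x = 0))"
proof -
  have um[measurable]: "u n \<in> borel_measurable lebesgue" for n
    using u[of n] by (simp add: LG_def lebesgue_on_UNIV_eq)
  obtain R a where R: "0 < R" and a: "0 < a" and Ra: "\<forall>w :: real ^ 'n \<Rightarrow> real. w \<in> LG G UNIV \<longrightarrow>
      Phi s G w \<le> ennreal P \<longrightarrow> ennreal \<delta> \<le> emeasure lebesgue {x. \<bar>w x\<bar> > \<tau>} \<longrightarrow>
      (\<exists>y. (\<forall>i. y $ i \<in> \<int>)
      \<and> ennreal a \<le> emeasure lebesgue {x \<in> ball 0 R. \<bar>w (x + y)\<bar> > \<tau> / 2}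
      \<and> ennreal a \<le> emeasure lebesgue {x \<in> ball 0 R. \<bar>w (x + y)\<bar> \<le> \<tau> / 2})"
    using exists_integer_translation[OF s \<tau> \<delta> P, where 'n = 'n] by (elim exE conjE)
  have "\<forall>n. \<exists>y. (\<forall>i. y $ i \<in> \<int>)
      \<and> ennreal a \<le> emeasure lebesgue {x \<in> ball 0 R. \<bar>u n (x + y)\<bar> > \<tau> / 2}
      \<and> ennreal a \<le> emeasure lebesgue {x \<in> ball 0 R. \<bar>u n (x + y)\<bar> \<le> \<tau> / 2}"
    using Ra[rule_format, OF u Phi super] by (intro allI)
  from choice[OF this] obtain y where "\<forall>n. (\<forall>i. y n $ i \<in> \<int>)
      \<and> ennreal a \<le> emeasure lebesgue {x \<in> ball 0 R. \<bar>u n (x + y n)\<bar> > \<tau> / 2}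
      \<and> ennreal a \<le> emeasure lebesgue {x \<in> ball 0 R. \<bar>u n (x + y n)\<bar> \<le> \<tau> / 2}"
    by (elim exE)
  then have y: "y n $ i \<in> \<int>"
    and upper: "ennreal a \<le> emeasure lebesgue {x \<in> ball 0 R. \<bar>u n (x + y n)\<bar> > \<tau> / 2}"
    and lower: "ennreal a \<le> emeasure lebesgue {x \<in> ball 0 R. \<bar>u n (x + y n)\<bar> \<le> \<tau> / 2}" for n i
    by simp_all
  define v where "v n x = u n (x + y n)" for n x
  have vm[measurable]: "v n \<in> borel_measurable lebesgue" for n
    unfolding v_def by measurable
  have vPhi: "Phi s G (v n) \<le> ennreal P" for n
    using Phi_translation[OF um, of s n "y n"] Phi[of n] unfolding v_def[abs_def] by simp
  have bdd: "\<exists>B. \<forall>n. (\<integral>\<^sup>+ x\<in>ball 0 (real m). eG (v n x) \<partial>lebesgue) \<le> ennreal B" for m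
  proof -
    have "0 \<le> \<tau> / 2" using \<tau> by simp
    from local_bound[OF s P R a this, where 'n = 'n and m = m] obtain B where
      B: "\<forall>w :: real ^ 'n \<Rightarrow> real. w \<in> borel_measurable lebesgue \<longrightarrow> Phi s G w \<le> ennreal P \<longrightarrow>
        ennreal a \<le> emeasure lebesgue {x \<in> ball 0 R. \<bar>w x\<bar> \<le> \<tau> / 2} \<longrightarrow>
        (\<integral>\<^sup>+ x\<in>ball 0 (real m). eG (w x) \<partial>lebesgue) \<le> ennreal B"
      by (elim exE)
    have "(\<integral>\<^sup>+ x\<in>ball 0 (real m). eG (v n x) \<partial>lebesgue) \<le> ennreal B" for n
      by (rule B[rule_format, OF vm vPhi]) (use lower in \<open>simp add: v_def\<close>)
    then show ?thesis by (intro exI allI)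
  qed
  obtain r :: "nat \<Rightarrow> nat" where r: "strict_mono r" and Cauchy: "\<And>m e. 0 < e \<Longrightarrow> \<exists>M. \<forall>j\<ge>M. \<forall>k\<ge>M.
      (\<integral>\<^sup>+ x\<in>ball 0 (real m). eG (v (r j) x - v (r k) x) \<partial>lebesgue) \<le> ennreal e"
    using eG_Cauchy_subsequence[OF vm s vPhi P bdd] by blast
  obtain w where w[measurable]: "w \<in> borel_measurable lebesgue" and lim: "\<And>m e. 0 < e \<Longrightarrow> \<exists>N. \<forall>k\<ge>N.
      (\<integral>\<^sup>+ x\<in>ball 0 (real m). eG (v (r k) x - w x) \<partial>lebesgue) \<le> ennreal e"
    using complete_eG[OF vm Cauchy] by blast
  have conv: "LG_loc_converges G (\<lambda>k. v (r k)) w"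
  proof (rule LG_loc_convergesI[OF vm w lim])
    fix k m
    obtain B where "\<forall>n. (\<integral>\<^sup>+ x\<in>ball 0 (real m). eG (v n x) \<partial>lebesgue) \<le> ennreal B"
      using bdd[of m] by (elim exE)
    then have "(\<integral>\<^sup>+ x\<in>ball 0 (real m). eG (v (r k) x) \<partial>lebesgue) \<le> ennreal B"
      by (rule spec)
    then show "(\<integral>\<^sup>+ x\<in>ball 0 (real m). eG (v (r k) x) \<partial>lebesgue) < \<infinity>"
      by (rule le_less_trans) simp
  qed
  moreover have "\<not> (AE x in lebesgue. w x = 0)"
  proof
    assume AE: "AE x in lebesgue. w x = 0"
    \<comment> \<open>Superlevel sets of measure at least a inside \<open>ball 0 R\<close> keep the
      modular of every translate at least c on any larger ball. A limit vanishing almost everywhere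
      would push it down to c / 2.\<close>
    define c where "c = G (\<tau> / 2) * a"
    have Gt: "0 < G (\<tau> / 2)" using \<tau> by (intro pos) simp
    have c: "0 < c" using a Gt by (simp add: c_def)
    obtain m where m: "R \<le> real m" using real_arch_simple by blast
    obtain k where k: "(\<integral>\<^sup>+ x\<in>ball 0 (real m). eG (v (r k) x - w x) \<partial>lebesgue) \<le> ennreal (c / 2)"
      using lim[of "c / 2" m] c by auto
    define A where "A = {x \<in> ball 0 R. \<bar>v (r k) x\<bar> > \<tau> / 2}"
    have "A = ball 0 R \<inter> {x. \<bar>v (r k) x\<bar> > \<tau> / 2}" by (auto simp: A_def)
    also have "\<dots> \<in> sets lebesgue"
      by (intro sets.Int sets_lebesgue_abs_superlevel[OF vm]) simp
    finally have A[measurable]: "A \<in> sets lebesgue" .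
    have "ennreal c = ennreal (G (\<tau> / 2)) * ennreal a"
      using a Gt by (simp add: c_def ennreal_mult)
    also have "\<dots> \<le> ennreal (G (\<tau> / 2)) * emeasure lebesgue A"
      using upper unfolding A_def v_def by (intro mult_left_mono) auto
    also have "\<dots> = (\<integral>\<^sup>+ x\<in>A. ennreal (G (\<tau> / 2)) \<partial>lebesgue)"
      by (rule nn_integral_cmult_indicator[symmetric]) measurable
    also have "\<dots> \<le> (\<integral>\<^sup>+ x\<in>ball 0 (real m). eG (v (r k) x - w x) \<partial>lebesgue)"
    proof (rule nn_integral_mono_AE)
      show "AE x in lebesgue. ennreal (G (\<tau> / 2)) * indicator A x \<le> eG (v (r k) x - w x) * indicator (ball 0 (real m)) x"
        using AE
      proof eventually_elim
        fix x assume "w x = 0"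
        then show "ennreal (G (\<tau> / 2)) * indicator A x \<le> eG (v (r k) x - w x) * indicator (ball 0 (real m)) x"
          using m \<tau> by (auto simp: A_def indicator_def intro!: ennreal_leI mono)
      qed
    qed
    also note k
    finally show False using c by (simp add: ennreal_le_iff)
  qed
  ultimately show ?thesis
    using y r unfolding v_def[abs_def] by blast
qed

end


theorem theorem1p5:
  fixes u :: "nat \<Rightarrow> real ^ 'n \<Rightarrow> real"
    and s pm pp M \<tau> \<delta> :: real
    and G g :: "real \<Rightarrow> real"
  assumes "CARD('n) \<ge> 3"
    and "0 < s" and "s < 1"
    and "young_function G g"
    and "C1_half_line G"
    and "1 \<le> pm"
    and "\<And>t. t > 0 \<Longrightarrow> pm \<le> t * g t / G t \<and> t * g t / G t \<le> pp"
    and "M > 0"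
    and "\<And>n. u n \<in> WsG s G"
    and "\<And>n. Phi s G (u n) < \<infinity>"
    and "\<And>n. enn2real (Phi s G (u n)) powr (1 / pm) \<le> M"
    and "\<And>n. enn2real (Phi s G (u n)) powr (1 / pp) \<le> M"
    and "\<tau> > 0" and "\<delta> > 0"
    and "\<And>n. emeasure lebesgue {x. \<bar>u n x\<bar> > \<tau>} \<ge> ennreal \<delta>"
  shows "\<exists>y :: nat \<Rightarrow> real ^ 'n. (\<forall>n i. y n $ i \<in> \<int>) \<and>
    (\<exists>r v. strict_mono r \<and>
       LG_loc_converges G (\<lambda>k x. u (r k) (x + y (r k))) v \<and>
       \<not> (AE x in lebesgue. v x = 0))"
proof -
  interpret delta2_young G
    using assms(4,5,7) young_function_delta2 by blast
  \<comment> \<open>Raising the root bound to the power \<open>pm\<close> gives one energy bound for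
    all n. Since \<open>enn2real\<close> sends infinity to 0, finiteness of \<open>Phi\<close> is
    used to return to \<open>ennreal\<close>.\<close>
  have "Phi s G (u n) \<le> ennreal (M powr pm)" for n
  proof -
    define p where "p = enn2real (Phi s G (u n))"
    have "p = (p powr (1 / pm)) powr pm"
      using assms(6) by (simp add: powr_powr p_def)
    also have "\<dots> \<le> M powr pm"
      using assms(6) assms(11)[of n] by (intro powr_mono2) (auto simp: p_def)
    finally have "ennreal p \<le> ennreal (M powr pm)" by (rule ennreal_leI)
    moreover have "ennreal p = Phi s G (u n)"
      using assms(10)[of n] by (simp add: p_def)
    ultimately show ?thesis by simp
  qed
  then show ?thesis
    using assms(2,9,13-15) by (intro translation_compactness[where P = "M powr pm" and s = s and \<tau> = \<tau> and \<delta> = \<delta>])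
      (auto simp: WsG_def)
qed

end
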